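(* Assume there is a ray on sheet 1, i.e. $\tilde\lambda_1>\tilde\mu$, where $\tilde\lambda_1=\lambda_1\mu/\lambda$ and $\tilde\mu=\lambda$. Then, as $\ell\to\infty$ through the positive integers, $$\pi(d(\ell),1)\ \sim\ B\,\rho^{\ell}\,\frac{1}{\sqrt{2\pi \ell/|m|}},$$ (in the square root $\pi$ is the number $3.14\ldots$) where $$B=\Big[\det(Q)\,\big(m\cdot \Sigma m\big)\Big]^{-1/2}\ \sum_{x=0}^{\infty}\rho^{-x}\,\pi(x,0,1)\,P_{(x,0)}\big[\mathcal M\text{ never hits }\blacktriangle\big].$$
   Context: Polling model. Let $\lambda_1,\lambda_2,\mu>0$, $\lambda=\lambda_1+\lambda_2<\mu$, $\lambda+\mu=1$, $\rho=\lambda/\mu$. State space ($x,y$ integers): $S=\{(0,0,1)\}\cup\{(x,y,1):x\ge1,y\ge0\}\cup\{(x,y,2):x\ge0,y\ge1\}$; $(x,y)$ are the lengths of queues 1, 2 and the last coordinate is the queue being served (sheet 1 or sheet 2). The transition kernel $K$ on $S$ is: from any $(x,y,s)\ne(0,0,1)$, go to $(x+1,y,s)$ with probability $\lambda_1$ and to $(x,y+1,s)$ with probability $\lambda_2$; from $(x,y,1)$ with $x>1$ go to $(x-1,y,1)$ with probability $\mu$; from $(1,y,1)$ with $y\ge1$ go to $(0,y,2)$ with probability $\mu$, and from $(1,0,1)$ go to $(0,0,1)$ with probability $\mu$; from $(x,y,2)$ with $y>1$ go to $(x,y-1,2)$ with probability $\mu$; from $(x,1,2)$ go to $(x,0,1)$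 with probability $\mu$; from $(0,0,1)$ go to $(1,0,1)$ with probability $\lambda_1$, to $(0,1,2)$ with probability $\lambda_2$, and stay with probability $\mu$. $K$ is irreducible with a unique stationary probability $\pi$. Twisted free walk on sheet 1. $\mathcal M$ is the random walk on $\mathbb Z^2$ whose increments equal $(1,0)$ with probability $\tilde\lambda_1=\lambda_1\mu/\lambda$, $(0,1)$ with probability $\tilde\lambda_2=\lambda_2\mu/\lambda$ and $(-1,0)$ with probability $\tilde\mu=\lambda$. Its mean increment is $m=(\tilde\lambda_1-\tilde\mu,\tilde\lambda_2)$, $Q$ is the $2\times2$ covariance matrix of an increment and $\Sigma=Q^{-1}$. $|(x,y)|=|x|+|y|$ is the $\ell^1$ norm. $d(\ell)$ denotes the lattice point on the line $\{x+y=\ell\}$ nearest to $\ell\, m/|m|$; for $d(\ell)=(x,y)$, $\pi(d(\ell),1)$ means $\pi(x,y,1)$. $\blacktriangle=\mathbb Z^2\setminus\{(x,y):x\ge1,\ y\ge1\}$. $P_{z}[\mathcal M\text{ never hits }\blacktriangle]$ is the probability that the walk started at $z$ at time $0$ is outside $\blacktriangle$ at all times $n\ge1$. $a_\ell\sim b_\ell$ means $a_\ell/b_\ell\to1$. *)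

theory Defs
  imports "HOL-Probability.Probability"
begin

text \<open>A state \<open>(x, y, s)\<close> of the polling model consists of the two queue lengths and the queue being served.\<close>

type_synonym state = "int \<times> int \<times> nat"

definition polling_states :: "state set" where
  "polling_states =
     {(0, 0, 1)} \<union> {(x, y, 1) | x y. x \<ge> 1 \<and> y \<ge> 0} \<union> {(x, y, 2) | x y. x \<ge> 0 \<and> y \<ge> 1}"

definition service :: "state \<Rightarrow> state" where
  "service = (\<lambda>(x, y, s).
     if s = 1 then
       (if x > 1 then (x - 1, y, 1) else if y \<ge> 1 then (0, y, 2) else (0, 0, 1))
     else
       (if y > 1 then (x, y - 1, 2) else (x, 0, 1)))"

text \<open>
  The kernel is a total function on the type \<open>state\<close>; only its values on
  \<open>polling_states\<close> are meaningful, and this set is closed under it (see below).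
  The lists are genuine probability distributions when the rates are nonnegative and sum to \<open>1\<close>.
\<close>

definition polling_kernel :: "real \<Rightarrow> real \<Rightarrow> real \<Rightarrow> state \<Rightarrow> state pmf" where
  "polling_kernel lam1 lam2 \<mu> = (\<lambda>(x, y, s).
     if (x, y, s) = (0, 0, 1) then
       pmf_of_list [((1, 0, 1), lam1), ((0, 1, 2), lam2), ((0, 0, 1), \<mu>)]
     else
       pmf_of_list [((x + 1, y, s), lam1), ((x, y + 1, s), lam2), (service (x, y, s), \<mu>)])"

lemma set_pmf_polling_kernel:
  assumes "lam1 > 0" "lam2 > 0" "\<mu> > 0" "lam1 + lam2 + \<mu> = 1" "z \<in> polling_states"
  shows "set_pmf (polling_kernel lam1 lam2 \<mu> z) \<subseteq> polling_states"
proof -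
  have wf: "pmf_of_list_wf [(a, lam1), (b, lam2), (c, \<mu>)]" for a b c :: state
    using assms by (auto simp: pmf_of_list_wf_def)
  show ?thesis
    using assms(5)
    by (auto simp: polling_kernel_def polling_states_def service_def
          dest!: subsetD[OF set_pmf_of_list[OF wf]] split: if_splits)
qed

definition stationary_on :: "'a set \<Rightarrow> ('a \<Rightarrow> 'a pmf) \<Rightarrow> 'a pmf \<Rightarrow> bool" where
  "stationary_on S K p \<longleftrightarrow> set_pmf p \<subseteq> S \<and> bind_pmf p K = p"


definition walk_increment :: "real \<Rightarrow> real \<Rightarrow> real \<Rightarrow> (int \<times> int) pmf" where
  "walk_increment a1 a2 b = pmf_of_list [((1, 0), a1), ((0, 1), a2), ((-1, 0), b)]"

definition vec_of_pair :: "int \<times> int \<Rightarrow> real ^ 2" where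
  "vec_of_pair z = vector [of_int (fst z), of_int (snd z)]"

definition mean_increment :: "(int \<times> int) pmf \<Rightarrow> real ^ 2" where
  "mean_increment F = (\<chi> i. measure_pmf.expectation F (\<lambda>v. vec_of_pair v $ i))"

definition covariance_matrix :: "(int \<times> int) pmf \<Rightarrow> real ^ 2 ^ 2" where
  "covariance_matrix F = (\<chi> i j. measure_pmf.expectation F
     (\<lambda>v. (vec_of_pair v $ i - mean_increment F $ i) * (vec_of_pair v $ j - mean_increment F $ j)))"

definition l1_norm :: "real ^ 2 \<Rightarrow> real" where
  "l1_norm v = (\<Sum>i\<in>UNIV. \<bar>v $ i\<bar>)"

lemma mean_increment_walk_increment:
  assumes "a1 \<ge> 0" "a2 \<ge> 0" "b \<ge> 0" "a1 + a2 + b = 1"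
  shows "mean_increment (walk_increment a1 a2 b) = vector [a1 - b, a2]"
proof -
  have wf: "pmf_of_list_wf [((1, 0), a1), ((0, 1), a2), ((-1, 0), b)]"
    using assms by (auto simp: pmf_of_list_wf_def)
  have "measure_pmf.expectation (walk_increment a1 a2 b) f
        = a1 * f (1, 0) + a2 * f (0, 1) + b * f (-1, 0)" for f :: "int \<times> int \<Rightarrow> real"
    unfolding walk_increment_def
    by (subst integral_measure_pmf[where A = "{(1, 0), (0, 1), (-1, 0)}"])
       (use set_pmf_of_list[OF wf] in \<open>auto simp: pmf_pmf_of_list[OF wf]\<close>)
  then show ?thesis
    by (simp add: mean_increment_def vec_of_pair_def vec_eq_iff forall_2)
qed

definition outside_quadrant :: "(int \<times> int) set" where
  "outside_quadrant = UNIV - {(x, y). x \<ge> 1 \<and> y \<ge> 1}"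

text \<open>
  The walk started at \<open>z\<close> is at \<open>z + (\<Sum>i<n. \<omega> i)\<close> at time \<open>n\<close>, with \<open>\<omega>\<close> an i.i.d. sequence of
  increments. Time \<open>0\<close> is not constrained, so \<open>z\<close> itself may lie in \<open>A\<close>.
\<close>

definition prob_never_hits :: "(int \<times> int) pmf \<Rightarrow> int \<times> int \<Rightarrow> (int \<times> int) set \<Rightarrow> real" where
  "prob_never_hits F z A =
     \<P>(\<omega> in (\<Pi>\<^sub>M i\<in>(UNIV :: nat set). measure_pmf F). \<forall>n\<ge>1. z + (\<Sum>i<n. \<omega> i) \<notin> A)"

lemma sets_never_hits:
  fixes F :: "(int \<times> int) pmf"
  defines "M \<equiv> (\<Pi>\<^sub>M i\<in>(UNIV :: nat set). measure_pmf F)"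
  shows "{\<omega> \<in> space M. \<forall>n\<ge>1. z + (\<Sum>i<n. \<omega> i) \<notin> A} \<in> sets M"
proof -
  have comp: "(\<lambda>\<omega>. \<omega> i) \<in> M \<rightarrow>\<^sub>M count_space UNIV" for i :: nat
    unfolding M_def by (rule measurable_cong_sets[THEN equalityD1, THEN subsetD,
          OF refl _ measurable_component_singleton]) auto
  have partial: "(\<lambda>\<omega>. \<Sum>i<n. \<omega> i) \<in> M \<rightarrow>\<^sub>M count_space UNIV" for n :: nat
  proof (induction n)
    case (Suc n)
    have "(\<lambda>\<omega>. (\<lambda>(u, v). u + v) (\<Sum>i<n. \<omega> i, \<omega> n)) \<in> M \<rightarrow>\<^sub>M count_space UNIV"
      by (rule measurable_compose[OF measurable_Pair[OF Suc comp[of n]]])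
         (simp add: pair_measure_countable)
    then show ?case by simp
  qed simp
  have "Measurable.pred M (\<lambda>\<omega>. z + (\<Sum>i<n. \<omega> i) \<notin> A)" for n :: nat
    by (rule measurable_compose[OF partial]) simp
  then show ?thesis
    by measurable
qed

text \<open>
  A lattice point on the line \<open>x + y = l\<close> nearest to \<open>(l / \<bar>m\<bar>) m\<close>. Two such points
  exist in case of a tie, so this is a relation rather than a function.
\<close>

definition nearest_on_line :: "real ^ 2 \<Rightarrow> nat \<Rightarrow> int \<times> int \<Rightarrow> bool" where
  "nearest_on_line m l =
     is_arg_min (\<lambda>z. dist (vec_of_pair z) ((real l / l1_norm m) *\<^sub>R m)) (\<lambda>z. fst z + snd z = int l)"

end

theory Submission
  imports Defs "HOL-Real_Asymp.Real_Asymp"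
begin

text \<open>
  Put \<open>a y x = \<rho> ^ (- (x + y)) * \<pi> (x, y, 1)\<close>. On the quadrant the stationarity equations say that
  \<open>a\<close> is an invariant measure of the twisted walk killed at \<open>x = 0\<close>, fed by row \<open>0\<close>. For the generating
  functions \<open>A y s = \<Sum>x. a y x * s ^ x\<close> this reads
  \<open>A (y + 1) s = psi s * (A y s - (q / p2) * a (y + 1) 1)\<close>, where \<open>psi\<close> is the generating function of
  the horizontal displacement of the walk between two consecutive upward steps. Unrolling the recursion
  on the unit circle and applying a local limit theorem to the powers of \<open>psi\<close> gives
  \<open>sqrt y * a y x \<longlongrightarrow> (A 0 1 - (q / p2) * \<Sum>j. a (j + 1) 1) / sqrt (2 * pi * var)\<close> along the ray. As
  \<open>psi r = 1\<close> for \<open>r = q / p1\<close>, the recursion at \<open>s = r\<close> shows that the subtracted sum is \<open>A 0 r\<close>, and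
  \<open>1 - r ^ x\<close> is the probability that the walk never reaches the axis. Summability of the rows of \<open>a\<close>,
  the main fact about \<open>\<pi>\<close> beyond local balance, comes from a Lyapunov function: under the ray condition
  every switch back to sheet 1 at some \<open>x \<ge> 1\<close> has probability at least \<open>1 - r\<close> of being the last one.
\<close>

section \<open>Trigonometric and Gaussian estimates\<close>

text \<open>The weight \<open>\<rho> ^ (- (x + y))\<close> is harmonic for the untwisted walk, since
  \<lambda> / \<rho> + \<mu> * \<rho> = \<mu> + \<lambda> = 1; this is why conjugating with it
  yields a probability walk again. The twisted walk has no downward step, so \<open>y\<close> acts
  as a time and each new row comes from the previous one by an i.i.d. displacement. Hence one
  variable \<open>s\<close> and a one-dimensional local limit theorem are enough. The weight also
  makes the measure infinite: the levels \<open>x + y = n\<close>, taken over both sheets, all carry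
  the same weighted mass, so summability of a row cannot be read off from \<pi> being a probability.
  The killing at \<open>x = 0\<close> is the other obstacle: the number of correction terms grows
  with \<open>y\<close>, and the limit is taken term by term because the killed masses decay
  geometrically. That decay is obtained at the real point \<open>sqrt r\<close>, inside the interval
  between \<open>r\<close> and 1 on which \<open>psi < 1\<close>.\<close>

lemma one_minus_cos_ge:
  fixes \<theta> :: real
  assumes "\<bar>\<theta>\<bar> \<le> pi"
  shows "\<theta>\<^sup>2 / 18 \<le> 1 - cos \<theta>"
proof -
  define u where "u = \<theta> / 2"
  have u: "\<bar>u\<bar> \<le> 2" using assms pi_less_4 by (simp add: u_def)
  have "\<bar>sin u - u\<bar> \<le> \<bar>u\<bar> ^ 3 / 6"
    using Maclaurin_sin_bound[of u 3] by (simp add: eval_nat_numeral sin_coeff_def fact_numeral)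
  also have "\<bar>u\<bar> ^ 3 / 6 = \<bar>u\<bar> * (\<bar>u\<bar> * \<bar>u\<bar>) / 6" by (simp add: power3_eq_cube)
  \<comment> \<open>The cubic error is at most two thirds of \<open>\<bar>u\<bar>\<close>, so a
    third is left for \<open>\<bar>sin u\<bar>\<close>; squaring and doubling turns this third into
    the constant 18.\<close>
  also have "\<dots> \<le> \<bar>u\<bar> * (2 * 2) / 6"
    using u by (intro divide_right_mono mult_left_mono mult_mono) auto
  finally have "\<bar>u\<bar> / 3 \<le> \<bar>sin u\<bar>" by linarith
  then have "(\<bar>u\<bar> / 3)\<^sup>2 \<le> \<bar>sin u\<bar>\<^sup>2" by (intro power_mono) auto
  then have "u\<^sup>2 / 9 \<le> (sin u)\<^sup>2" by (simp add: power_divide)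
  moreover have "cos \<theta> = 1 - 2 * (sin u)\<^sup>2"
    using cos_double_sin[of u] by (simp add: u_def)
  ultimately show ?thesis by (simp add: u_def power_divide)
qed

lemma cis_taylor2:
  "cmod (cis u - (1 + \<i> * of_real u - of_real (u\<^sup>2 / 2))) \<le> \<bar>u\<bar> ^ 3 / 6"
  using iexp_approx1[of u 2]
  by (simp add: cis_conv_exp eval_nat_numeral fact_numeral power2_eq_square field_simps)

text \<open>For \<open>w = exp (- c / n)\<close> the power \<open>w ^ n\<close> is exactly
  \<open>exp (- c)\<close>, and in the closed unit disc \<open>z ^ n\<close> and
  \<open>w ^ n\<close> differ by at most \<open>n\<close> times the distance of \<open>z\<close> and
  \<open>w\<close>. This comparison replaces a complex logarithm.\<close>

lemma tendsto_power_exp: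
  fixes z :: "nat \<Rightarrow> complex" and n :: "nat \<Rightarrow> nat"
  assumes n: "filterlim n at_top sequentially"
    and z: "\<And>l. cmod (z l) \<le> 1"
    and lim: "(\<lambda>l. of_nat (n l) * (z l - 1)) \<longlonglongrightarrow> of_real (- c)" and c: "c \<ge> 0"
  shows "(\<lambda>l. z l ^ n l) \<longlonglongrightarrow> of_real (exp (- c))"
proof -
  define w where "w l = exp (- c / real (n l))" for l
  have w: "cmod (of_real (w l)) \<le> 1" for l
    using c by (simp add: w_def)
  have "((\<lambda>x::nat. real x * (exp (- c / real x) - 1)) \<longlonglongrightarrow> - c)"
    by real_asymp
  then have "(\<lambda>l. real (n l) * (w l - 1)) \<longlonglongrightarrow> - c"
    unfolding w_def by (rule filterlim_compose[OF _ n])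
  then have "(\<lambda>l. complex_of_real (real (n l) * (w l - 1))) \<longlonglongrightarrow> of_real (- c)"
    by (rule tendsto_of_real)
  then have "(\<lambda>l. of_nat (n l) * (z l - 1) - complex_of_real (real (n l) * (w l - 1))) \<longlonglongrightarrow> 0"
    using tendsto_diff[OF lim] by fastforce
  moreover have "of_nat (n l) * (z l - 1) - complex_of_real (real (n l) * (w l - 1))
      = of_nat (n l) * (z l - of_real (w l))" for l
    by (simp add: algebra_simps)
  ultimately have "(\<lambda>l. cmod (of_nat (n l) * (z l - of_real (w l)))) \<longlonglongrightarrow> 0"
    using tendsto_norm_zero by fastforce
  then have "(\<lambda>l. real (n l) * cmod (z l - of_real (w l))) \<longlonglongrightarrow> 0"
    by (simp add: norm_mult)
  then have *: "(\<lambda>l. z l ^ n l - of_real (w l) ^ n l) \<longlonglongrightarrow> 0"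
    by (rule Lim_null_comparison[rotated])
      (intro always_eventually allI norm_power_diff z w)
  have "eventually (\<lambda>l. n l \<ge> 1) sequentially"
    using n filterlim_at_top by blast
  then have "eventually (\<lambda>l. of_real (exp (- c)) = (of_real (w l) :: complex) ^ n l) sequentially"
    by eventually_elim (simp add: w_def flip: of_real_power exp_of_nat_mult)
  then have "(\<lambda>l. (of_real (w l) :: complex) ^ n l) \<longlonglongrightarrow> of_real (exp (- c))"
    by (rule Lim_transform_eventually[OF tendsto_const])
  from tendsto_add[OF * this] show ?thesis by simp
qed

lemma integral_gaussian:
  fixes v :: real
  assumes "v > 0"
  shows "integrable lborel (\<lambda>t. exp (- (v * t\<^sup>2 / 2)))"
    and "(\<integral>t. exp (- (v * t\<^sup>2 / 2)) \<partial>lborel) = sqrt (2 * pi / v)"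
proof -
  define s where "s = 1 / sqrt v"
  have eq: "exp (- (v * t\<^sup>2 / 2)) = sqrt (2 * pi / v) * normal_density 0 s t" for t
    using assms by (simp add: normal_density_def s_def field_simps real_sqrt_divide real_sqrt_mult)
  have "s > 0" using assms by (simp add: s_def)
  then show "integrable lborel (\<lambda>t. exp (- (v * t\<^sup>2 / 2)))"
    and "(\<integral>t. exp (- (v * t\<^sup>2 / 2)) \<partial>lborel) = sqrt (2 * pi / v)"
    unfolding eq by auto
qed

section \<open>Fourier coefficients of absolutely convergent series\<close>

lemma integral_cis_multiple:
  fixes k :: int
  shows "(\<integral>\<theta>. indicator {-pi..pi} \<theta> *\<^sub>R cis (k * \<theta>) \<partial>lborel) = (if k = 0 then of_real (2 * pi) else 0)"
proof (cases "k = 0")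
  case True
  have "(\<integral>\<theta>. indicator {-pi..pi} \<theta> *\<^sub>R (1 :: complex) \<partial>lborel) = of_real (2 * pi)"
    by (subst integral_FTC_atLeastAtMost[where F = of_real])
       (auto intro!: derivative_eq_intros has_vector_derivative_of_real)
  then show ?thesis using True by simp
next
  case False
  have "(\<integral>\<theta>. indicator {-pi..pi} \<theta> *\<^sub>R cis (k * \<theta>) \<partial>lborel)
      = cis (k * pi) / (\<i> * k) - cis (k * - pi) / (\<i> * k)"
  proof (rule integral_FTC_atLeastAtMost)
    fix x :: real
    show "((\<lambda>x. cis (k * x) / (\<i> * k)) has_vector_derivative cis (k * x)) (at x within {-pi..pi})"
      unfolding has_vector_derivative_def using False
      by (auto intro!: derivative_eq_intros simp: scaleR_conv_of_real mult_ac)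
  qed (auto intro!: continuous_intros)
  also have "cis (k * pi) = cis (k * - pi) * cis (2 * pi * k)"
    unfolding cis_mult by (simp add: algebra_simps)
  then have "cis (k * pi) / (\<i> * k) - cis (k * - pi) / (\<i> * k) = 0"
    by (simp add: cis_multiple_2pi)
  finally show ?thesis using False by simp
qed

text \<open>Absolute summability lets the integral pass through the series, and orthogonality leaves
  the term \<open>i = x\<close>.\<close>

lemma fourier_coefficient:
  fixes a :: "nat \<Rightarrow> real"
  assumes a: "\<And>x. a x \<ge> 0" and s: "summable a"
  shows "(\<integral>\<theta>. indicator {-pi..pi} \<theta> *\<^sub>R ((\<Sum>i. of_real (a i) * cis \<theta> ^ i) * cis (- real x * \<theta>)) \<partial>lborel)
     = of_real (2 * pi * a x)"
proof -
  define f where "f i \<theta> = indicator {-pi..pi} \<theta> *\<^sub>R (of_real (a i) * cis (of_int (int i - int x) * \<theta>))"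
    for i and \<theta> :: real
  have n: "norm (f i \<theta>) = indicator {-pi..pi} \<theta> * a i" for i \<theta>
    using a by (simp add: f_def norm_mult)
  have [measurable]: "(\<lambda>\<theta>. cis (c * \<theta>)) \<in> borel_measurable borel" for c
    by (intro borel_measurable_continuous_onI continuous_intros)
  have [measurable]: "f i \<in> borel_measurable borel" for i
    unfolding f_def by measurable
  have ni: "integrable lborel (\<lambda>\<theta>. indicator {-pi..pi} \<theta> * a i)" for i
    by (intro integrable_mult_left) (auto simp: integrable_indicator_iff)
  have int: "integrable lborel (f i)" for i
    by (rule Bochner_Integration.integrable_bound[OF ni[of i]]) (use n a in auto)
  have "(\<integral>\<theta>. (\<Sum>i. f i \<theta>) \<partial>lborel) = (\<Sum>i. \<integral>\<theta>. f i \<theta> \<partial>lborel)"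
  proof (rule integral_suminf[OF int])
    show "AE \<theta> in lborel. summable (\<lambda>i. norm (f i \<theta>))"
      unfolding n using s by (intro AE_I2 summable_mult)
    show "summable (\<lambda>i. \<integral>\<theta>. norm (f i \<theta>) \<partial>lborel)"
      unfolding n using s by (simp add: summable_mult)
  qed
  also have "(\<lambda>i. \<integral>\<theta>. f i \<theta> \<partial>lborel) = (\<lambda>i. if i = x then of_real (2 * pi * a x) else 0)"
  proof
    fix i
    have "(\<integral>\<theta>. f i \<theta> \<partial>lborel) = of_real (a i) * (\<integral>\<theta>. indicator {-pi..pi} \<theta> *\<^sub>R cis (of_int (int i - int x) * \<theta>) \<partial>lborel)"
      unfolding f_def by (subst integral_mult_right_zero[symmetric]) (simp add: mult_ac)
    then show "(\<integral>\<theta>. f i \<theta> \<partial>lborel) = (if i = x then of_real (2 * pi * a x) else 0)"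
      using integral_cis_multiple[of "int i - int x"] by auto
  qed
  also have "(\<Sum>i. if i = x then of_real (2 * pi * a x) else 0) = (of_real (2 * pi * a x) :: complex)"
    using sums_single[of x "\<lambda>_. of_real (2 * pi * a x) :: complex"] by (simp add: sums_iff)
  also have "(\<lambda>\<theta>. \<Sum>i. f i \<theta>)
    = (\<lambda>\<theta>. indicator {-pi..pi} \<theta> *\<^sub>R ((\<Sum>i. of_real (a i) * cis \<theta> ^ i) * cis (- real x * \<theta>)))"
  proof
    fix \<theta>
    have "summable (\<lambda>i. of_real (a i) * cis \<theta> ^ i)"
      by (rule summable_comparison_test'[OF s, of 0]) (use a in \<open>auto simp: norm_mult norm_power\<close>)
    then have "(\<lambda>i. indicator {-pi..pi} \<theta> *\<^sub>R (of_real (a i) * cis \<theta> ^ i * cis (- real x * \<theta>)))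
       sums (indicator {-pi..pi} \<theta> *\<^sub>R ((\<Sum>i. of_real (a i) * cis \<theta> ^ i) * cis (- real x * \<theta>)))"
      by (intro sums_scaleR_right sums_mult2 summable_sums)
    moreover have "indicator {-pi..pi} \<theta> *\<^sub>R (of_real (a i) * cis \<theta> ^ i * cis (- real x * \<theta>)) = f i \<theta>" for i
      unfolding f_def Complex.DeMoivre by (simp add: mult.assoc cis_mult algebra_simps)
    ultimately have "(\<lambda>i. f i \<theta>) sums
        (indicator {-pi..pi} \<theta> *\<^sub>R ((\<Sum>i. of_real (a i) * cis \<theta> ^ i) * cis (- real x * \<theta>)))"
      by (simp only:)
    then show "(\<Sum>i. f i \<theta>) = indicator {-pi..pi} \<theta> *\<^sub>R ((\<Sum>i. of_real (a i) * cis \<theta> ^ i) * cis (- real x * \<theta>))"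
      by (rule sums_unique[symmetric])
  qed
  finally show ?thesis .
qed

lemma continuous_on_power_series_cis:
  fixes a :: "nat \<Rightarrow> real"
  assumes a: "\<And>x. a x \<ge> 0" and s: "summable a"
  shows "continuous_on UNIV (\<lambda>\<theta>. \<Sum>i. of_real (a i) * cis \<theta> ^ i)"
proof (rule uniform_limit_theorem)
  show "uniform_limit UNIV (\<lambda>n \<theta>. \<Sum>i<n. of_real (a i) * cis \<theta> ^ i)
      (\<lambda>\<theta>. \<Sum>i. of_real (a i) * cis \<theta> ^ i) sequentially"
    by (rule Weierstrass_m_test[OF _ s]) (use a in \<open>auto simp: norm_mult norm_power\<close>)
qed (auto intro!: always_eventually continuous_intros)

section \<open>Walks avoiding a set\<close>

lemma expectation_pmf_of_list3:
  fixes f :: "'a \<Rightarrow> real"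
  assumes "u \<ge> 0" "v \<ge> 0" "w \<ge> 0" "u + v + w = 1"
  shows "measure_pmf.expectation (pmf_of_list [(x, u), (y, v), (z, w)]) f = u * f x + v * f y + w * f z"
proof -
  have wf: "pmf_of_list_wf [(x, u), (y, v), (z, w)]"
    using assms by (auto simp: pmf_of_list_wf_def)
  have "measure_pmf.expectation (pmf_of_list [(x, u), (y, v), (z, w)]) f
      = (\<Sum>a\<in>{x, y, z}. pmf (pmf_of_list [(x, u), (y, v), (z, w)]) a *\<^sub>R f a)"
    by (rule integral_measure_pmf) (use set_pmf_of_list[OF wf] in auto)
  also have "\<dots> = u * f x + v * f y + w * f z"
  proof -
    \<comment> \<open>The points are not assumed distinct: splitting the mass into three
      \<open>if\<close> terms counts every weight once, even when \<open>{x, y, z}\<close>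
      collapses.\<close>
    have "(\<Sum>a\<in>{x, y, z}. pmf (pmf_of_list [(x, u), (y, v), (z, w)]) a *\<^sub>R f a)
        = (\<Sum>a\<in>{x, y, z}. (if a = x then u * f x else 0) + (if a = y then v * f y else 0) + (if a = z then w * f z else 0))"
      by (intro sum.cong) (auto simp: pmf_pmf_of_list[OF wf] algebra_simps)
    then show ?thesis by (simp add: sum.distrib)
  qed
  finally show ?thesis .
qed

text \<open>The finite-horizon event, which obeys a one-step recursion. Time 0 is exempt because the
  walk of interest starts on the axis, inside the forbidden set.\<close>

definition avoids :: "(int \<times> int) set \<Rightarrow> nat \<Rightarrow> int \<times> int \<Rightarrow> (nat \<Rightarrow> int \<times> int) \<Rightarrow> bool" where
  "avoids A n z \<omega> \<longleftrightarrow> (\<forall>k\<in>{1..n}. z + (\<Sum>i<k. \<omega> i) \<notin> A)"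

text \<open>Once the first step is split off, the shifted walk must avoid \<open>A\<close> at its
  own time 0 as well; \<open>avoids\<close> does not test this, hence the separate condition on
  \<open>z + v\<close>.\<close>

lemma avoids_case_nat:
  "avoids A (Suc n) z (case_nat v \<omega>) \<longleftrightarrow> z + v \<notin> A \<and> avoids A n (z + v) \<omega>"
proof -
  have "avoids A (Suc n) z (case_nat v \<omega>) \<longleftrightarrow> (\<forall>k\<in>{0..n}. z + (\<Sum>i<Suc k. case_nat v \<omega> i) \<notin> A)"
    unfolding avoids_def by (simp add: image_Suc_atLeastAtMost[of 0 n, symmetric] del: image_Suc_atLeastAtMost sum.lessThan_Suc)
  also have "\<dots> \<longleftrightarrow> (\<forall>k\<in>{0..n}. (z + v) + (\<Sum>i<k. \<omega> i) \<notin> A)"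
    by (simp only: sum.lessThan_Suc_shift) (simp add: add.assoc)
  also have "\<dots> \<longleftrightarrow> z + v \<notin> A \<and> avoids A n (z + v) \<omega>"
    unfolding avoids_def by (simp add: atLeastAtMost_insertL[of 0 n, symmetric] del: atLeastAtMost_insertL)
  finally show ?thesis .
qed

context
  fixes F :: "(int \<times> int) pmf"
begin

abbreviation "increments \<equiv> (\<Pi>\<^sub>M i\<in>(UNIV :: nat set). measure_pmf F)"

lemma sets_avoids: "{\<omega> \<in> space increments. avoids A n z \<omega>} \<in> sets increments"
proof -
  have comp: "(\<lambda>\<omega>. \<omega> i) \<in> increments \<rightarrow>\<^sub>M count_space UNIV" for i :: nat
    by (rule measurable_cong_sets[THEN equalityD1, THEN subsetD,
          OF refl _ measurable_component_singleton]) auto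
  have partial: "(\<lambda>\<omega>. \<Sum>i<n. \<omega> i) \<in> increments \<rightarrow>\<^sub>M count_space UNIV" for n :: nat
  proof (induction n)
    case (Suc n)
    have "(\<lambda>\<omega>. (\<lambda>(u, v). u + v) (\<Sum>i<n. \<omega> i, \<omega> n)) \<in> increments \<rightarrow>\<^sub>M count_space UNIV"
      by (rule measurable_compose[OF measurable_Pair[OF Suc comp[of n]]])
         (simp add: pair_measure_countable)
    then show ?case by simp
  qed simp
  have "Measurable.pred increments (\<lambda>\<omega>. z + (\<Sum>i<n. \<omega> i) \<notin> A)" for n :: nat
    by (rule measurable_compose[OF partial]) simp
  then show ?thesis
    unfolding avoids_def by measurable
qed

definition survival :: "(int \<times> int) set \<Rightarrow> nat \<Rightarrow> int \<times> int \<Rightarrow> real" where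
  "survival A n z = measure increments {\<omega> \<in> space increments. avoids A n z \<omega>}"

lemma prob_space_increments: "prob_space increments"
  by (intro prob_space_PiM measure_pmf.prob_space_axioms)

lemma survival_0: "survival A 0 z = 1"
  using prob_space.prob_space[OF prob_space_increments] by (simp add: survival_def avoids_def)

lemma survival_le_1: "survival A n z \<le> 1"
  unfolding survival_def by (rule prob_space.prob_le_1[OF prob_space_increments])

text \<open>Markov property at time 1: \<open>PiM_iter\<close> splits an i.i.d. sequence into its
  first entry and an independent copy of the whole sequence, and Fubini integrates over the first
  entry.\<close>

lemma survival_Suc:
  "survival A (Suc n) z = measure_pmf.expectation F (\<lambda>v. if z + v \<in> A then 0 else survival A n (z + v))"
proof -
  let ?f = "\<lambda>(s, \<omega>). case_nat s \<omega>" and ?E = "{\<omega> \<in> space increments. avoids A (Suc n) z \<omega>}"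
  have f: "?f \<in> measure_pmf F \<Otimes>\<^sub>M increments \<rightarrow>\<^sub>M increments"
    by (simp add: measurable_case_nat' split_beta') 
  have sp: "space increments = UNIV" by (simp add: space_PiM)
  interpret prob_space increments by (rule prob_space_increments)
  interpret sequence_space "measure_pmf F" by unfold_locales
  have vi: "?f -` ?E \<inter> space (measure_pmf F \<Otimes>\<^sub>M increments) \<in> sets (measure_pmf F \<Otimes>\<^sub>M increments)"
    using f sets_avoids by (rule measurable_sets)
  have "emeasure increments ?E = emeasure (distr (measure_pmf F \<Otimes>\<^sub>M increments) increments ?f) ?E"
    by (simp only: PiM_iter)
  also have "\<dots> = emeasure (measure_pmf F \<Otimes>\<^sub>M increments) (?f -` ?E \<inter> space (measure_pmf F \<Otimes>\<^sub>M increments))"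
    by (rule emeasure_distr[OF f sets_avoids])
  also have "\<dots> = (\<integral>\<^sup>+v. emeasure increments (Pair v -` (?f -` ?E \<inter> space (measure_pmf F \<Otimes>\<^sub>M increments))) \<partial>measure_pmf F)"
    by (rule emeasure_pair_measure_alt[OF vi])
  also have "\<dots> = (\<integral>\<^sup>+v. ennreal (if z + v \<in> A then 0 else survival A n (z + v)) \<partial>measure_pmf F)"
  proof (rule nn_integral_cong)
    fix v
    have "Pair v -` (?f -` ?E \<inter> space (measure_pmf F \<Otimes>\<^sub>M increments))
        = (if z + v \<in> A then {} else {\<omega> \<in> space increments. avoids A n (z + v) \<omega>})"
      by (auto simp: sp space_pair_measure avoids_case_nat)
    then show "emeasure increments (Pair v -` (?f -` ?E \<inter> space (measure_pmf F \<Otimes>\<^sub>M increments)))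
        = ennreal (if z + v \<in> A then 0 else survival A n (z + v))"
      by (simp add: survival_def emeasure_eq_measure)
  qed
  also have "\<dots> = ennreal (measure_pmf.expectation F (\<lambda>v. if z + v \<in> A then 0 else survival A n (z + v)))"
    by (intro nn_integral_eq_integral measure_pmf.integrable_const_bound[where B = 1])
       (auto simp: survival_def)
  finally show ?thesis
    by (simp add: survival_def emeasure_eq_measure integral_nonneg_AE)
qed

lemma survival_tendsto: "(\<lambda>n. survival A n z) \<longlonglongrightarrow> prob_never_hits F z A"
proof -
  interpret prob_space increments by (rule prob_space_increments)
  have "(\<lambda>n. measure increments {\<omega> \<in> space increments. avoids A n z \<omega>})
      \<longlonglongrightarrow> measure increments (\<Inter>n. {\<omega> \<in> space increments. avoids A n z \<omega>})"
  proof (rule finite_Lim_measure_decseq)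
    show "range (\<lambda>n. {\<omega> \<in> space increments. avoids A n z \<omega>}) \<subseteq> sets increments"
      by (intro image_subsetI sets_avoids)
  qed (auto simp: decseq_def avoids_def)
  also have "(\<Inter>n. {\<omega> \<in> space increments. avoids A n z \<omega>}) = {\<omega> \<in> space increments. \<forall>n\<ge>1. z + (\<Sum>i<n. \<omega> i) \<notin> A}"
  proof -
    have "(\<forall>m. avoids A m z \<omega>) \<longleftrightarrow> (\<forall>n\<ge>1. z + (\<Sum>i<n. \<omega> i) \<notin> A)" for \<omega>
      unfolding avoids_def using order_refl by (metis atLeastAtMost_iff)
    then show ?thesis by auto
  qed
  finally show ?thesis by (simp add: survival_def prob_never_hits_def)
qed

end

section \<open>Planar linear algebra and lattice points near a ray\<close>

lemma det_quadratic_form_inverse: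
  fixes A :: "real ^ 2 ^ 2" and v :: "real ^ 2"
  assumes "det A \<noteq> 0"
  shows "det A * (v \<bullet> (matrix_inv A *v v))
    = A$2$2 * (v$1)\<^sup>2 - (A$1$2 + A$2$1) * (v$1 * v$2) + A$1$1 * (v$2)\<^sup>2"
proof -
  define w where "w = matrix_inv A *v v"
  have "invertible A" using assms by (simp add: invertible_det_nz)
  then have "A ** matrix_inv A = mat 1"
    unfolding invertible_def matrix_inv_def by (metis (mono_tags, lifting) someI_ex)
  \<comment> \<open>Writing \<open>v\<close> as \<open>A *v w\<close> makes the claim a polynomial
    identity in the entries of \<open>A\<close> and \<open>w\<close>; its right-hand side is the
    quadratic form of the adjugate.\<close>
  then have "A *v w = v" by (simp add: w_def matrix_vector_mul_assoc)
  then have v: "v$1 = A$1$1 * w$1 + A$1$2 * w$2" "v$2 = A$2$1 * w$1 + A$2$2 * w$2"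
    by (auto simp: matrix_vector_mult_def sum_2 vec_eq_iff forall_2)
  have "v \<bullet> w = v$1 * w$1 + v$2 * w$2"
    by (simp add: inner_vec_def sum_2)
  then show ?thesis
    unfolding w_def[symmetric] det_2 v by (simp add: power2_eq_square algebra_simps)
qed

lemma nearest_on_line_components:
  fixes m :: "real ^ 2"
  assumes m: "m$1 > 0" "m$2 > 0" and near: "nearest_on_line m l z"
  shows "fst z + snd z = int l"
    and "\<bar>of_int (fst z) - real l * m$1 / (m$1 + m$2)\<bar> \<le> 2"
    and "\<bar>of_int (snd z) - real l * m$2 / (m$1 + m$2)\<bar> \<le> 2"
proof -
  have L: "l1_norm m = m$1 + m$2" using m by (simp add: l1_norm_def sum_2)
  define t where "t = (real l / l1_norm m) *\<^sub>R m"
  have t1: "t$1 = real l * m$1 / (m$1 + m$2)" and t2: "t$2 = real l * m$2 / (m$1 + m$2)"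
    by (simp_all add: t_def L)
  have tt: "t$1 + t$2 = real l"
    using m unfolding t1 t2 by (simp add: add_divide_distrib[symmetric] distrib_left[symmetric])
  \<comment> \<open>A competitor on the line: the coordinates of \<open>t\<close> add up to
    \<open>l\<close>, so both coordinates of the error of \<open>u\<close> have the same size, below
    1. Every minimiser, in case of a tie as well, is therefore within distance 2 of
    \<open>t\<close>.\<close>
  define u where "u = (\<lfloor>t$1\<rfloor>, int l - \<lfloor>t$1\<rfloor>)"
  show "fst z + snd z = int l"
    using near by (simp add: nearest_on_line_def is_arg_min_def)
  have "dist (vec_of_pair z) t \<le> dist (vec_of_pair u) t"
    using near by (auto simp: nearest_on_line_def is_arg_min_def u_def t_def not_less)
  also have "dist (vec_of_pair u) t \<le> \<bar>(vec_of_pair u - t)$1\<bar> + \<bar>(vec_of_pair u - t)$2\<bar>"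
    using norm_le_l1_cart[of "vec_of_pair u - t"] by (simp add: dist_norm sum_2)
  also have "\<dots> \<le> 2"
    using tt by (simp add: vec_of_pair_def u_def) linarith
  finally have d: "norm (vec_of_pair z - t) \<le> 2" by (simp add: dist_norm)
  then show "\<bar>of_int (fst z) - real l * m$1 / (m$1 + m$2)\<bar> \<le> 2"
    and "\<bar>of_int (snd z) - real l * m$2 / (m$1 + m$2)\<bar> \<le> 2"
    using component_le_norm_cart[of "vec_of_pair z - t" 1] component_le_norm_cart[of "vec_of_pair z - t" 2]
    by (simp_all add: vec_of_pair_def flip: t1 t2)
qed

section \<open>Levels, and stationarity tested on bounded functions\<close>

definition level :: "state \<Rightarrow> nat" where
  "level = (\<lambda>(x, y, s). nat (x + y))"

lemma expectation_bounded:
  fixes f :: "'a \<Rightarrow> real"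
  assumes "\<And>z. 0 \<le> f z" "\<And>z. f z \<le> B"
  shows "integrable (measure_pmf M) f" "0 \<le> measure_pmf.expectation M f" "measure_pmf.expectation M f \<le> B"
proof -
  show int: "integrable (measure_pmf M) f"
    by (rule measure_pmf.integrable_const_bound[where B = B]) (use assms in auto)
  show "0 \<le> measure_pmf.expectation M f" "measure_pmf.expectation M f \<le> B"
    using assms int by (auto intro: measure_pmf.integral_le_const integral_nonneg_AE)
qed

text \<open>The integral passes through \<open>bind_pmf\<close> in \<open>ennreal\<close>, and
  boundedness of \<open>f\<close> brings the equation back to real integrals. An unbounded test
  function has to be truncated before it can be used here.\<close>

lemma stationary_expectation:
  fixes f :: "'a \<Rightarrow> real"
  assumes st: "stationary_on S K p" and f0: "\<And>z. 0 \<le> f z" and fB: "\<And>z. f z \<le> B"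
  shows "measure_pmf.expectation p f = measure_pmf.expectation p (\<lambda>z. measure_pmf.expectation (K z) f)"
proof -
  have int: "integrable (measure_pmf M) f" for M
    by (rule expectation_bounded(1)[where B = B]) (use f0 fB in auto)
  have B: "0 \<le> measure_pmf.expectation M f" "measure_pmf.expectation M f \<le> B" for M
    by (rule expectation_bounded[where B = B]; use f0 fB in simp)+
  have "ennreal (measure_pmf.expectation p f) = (\<integral>\<^sup>+z. ennreal (f z) \<partial>measure_pmf p)"
    by (rule nn_integral_eq_integral[symmetric]) (use int f0 in auto)
  also have "\<dots> = (\<integral>\<^sup>+z. \<integral>\<^sup>+w. ennreal (f w) \<partial>measure_pmf (K z) \<partial>measure_pmf p)"
    using st by (metis stationary_on_def nn_integral_bind_pmf)
  also have "\<dots> = (\<integral>\<^sup>+z. ennreal (measure_pmf.expectation (K z) f) \<partial>measure_pmf p)"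
    by (intro nn_integral_cong nn_integral_eq_integral int) (use f0 in auto)
  also have "\<dots> = ennreal (measure_pmf.expectation p (\<lambda>z. measure_pmf.expectation (K z) f))"
    by (intro nn_integral_eq_integral measure_pmf.integrable_const_bound[where B = B]) (use B in auto)
  finally show ?thesis
    using f0 B by (simp add: integral_nonneg_AE)
qed

section \<open>The twisted walk\<close>

locale drift_walk =
  fixes p1 p2 q :: real
  assumes p1_pos: "p1 > 0" and p2_pos: "p2 > 0" and q_pos: "q > 0"
    and sum_one: "p1 + p2 + q = 1" and drift: "q < p1"
begin

text \<open>\<open>ratio\<close> is the gambler's ruin probability of ever going one unit to the
  left; \<open>slope\<close> and \<open>var\<close> are the mean and the variance of the horizontal
  displacement between two upward steps, a sum of a geometric number of unit steps.\<close>

definition ratio :: real where "ratio = q / p1"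
definition slope :: real where "slope = (p1 - q) / p2"
definition var :: real where "var = slope\<^sup>2 + (1 - p2) / p2"
text \<open>Polymorphic, since it is evaluated at complex points of the unit circle and at the real
  points \<open>ratio\<close> and \<open>sqrt ratio\<close>.\<close>

definition psi :: "'a::real_normed_field \<Rightarrow> 'a" where
  "psi s = of_real p2 / (1 - of_real p1 * s - of_real q / s)"

lemma ratio_pos: "0 < ratio" and ratio_less_1: "ratio < 1"
  using p1_pos q_pos drift by (auto simp: ratio_def)

lemma var_pos: "var > 0"
proof -
  have "p2 < 1" using sum_one p1_pos q_pos by linarith
  then show ?thesis using p2_pos by (simp add: var_def add_nonneg_pos)
qed

section \<open>Size of \<open>psi\<close> on the unit circle\<close>

lemma denom_cis: "p2 + (p1 + q) * (1 - cos \<theta>) \<le> cmod (1 - of_real p1 * cis \<theta> - of_real q / cis \<theta>)"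
proof -
  have "Re (1 - of_real p1 * cis \<theta> - of_real q * cis (-\<theta>)) = p2 + (p1 + q) * (1 - cos \<theta>)"
    using sum_one by (simp add: algebra_simps)
  then show ?thesis
    using complex_Re_le_cmod by (metis cis_inverse divide_inverse)
qed

lemma denom_cis_nz: "1 - of_real p1 * cis \<theta> - of_real q / cis \<theta> \<noteq> 0"
proof -
  have "0 < p2 + (p1 + q) * (1 - cos \<theta>)"
    using p1_pos p2_pos q_pos by (intro add_pos_nonneg mult_nonneg_nonneg) auto
  with denom_cis[of \<theta>] show ?thesis by auto
qed

lemma psi_bound: "cmod (psi (cis \<theta>)) \<le> 1"
proof -
  have "p2 \<le> cmod (1 - of_real p1 * cis \<theta> - of_real q / cis \<theta>)"
  proof -
    have "0 \<le> (p1 + q) * (1 - cos \<theta>)"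
      using p1_pos q_pos by (intro mult_nonneg_nonneg) auto
    then show ?thesis using denom_cis[of \<theta>] by linarith
  qed
  then show ?thesis
    using p2_pos denom_cis_nz[of \<theta>] by (simp add: psi_def norm_divide divide_le_eq_1)
qed

text \<open>With \<open>b = (p1 + q) / (18 * p2)\<close> the modulus of \<open>psi\<close> is at
  most \<open>1 / (1 + b * \<theta>^2)\<close>, hence at most
  \<open>exp (- b * \<theta>^2 / (1 + b * \<theta>^2))\<close>. The rate freezes the last
  denominator at \<open>\<theta> = pi\<close>.\<close>

definition gauss_rate :: real where "gauss_rate = (p1 + q) / (18 * p2) / (1 + (p1 + q) / (18 * p2) * pi\<^sup>2)"

lemma gauss_rate_pos: "gauss_rate > 0"
  using p1_pos p2_pos q_pos unfolding gauss_rate_def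
  by (intro divide_pos_pos add_pos_nonneg mult_nonneg_nonneg mult_pos_pos add_pos_pos) auto

lemma psi_gauss_bound:
  assumes "\<bar>\<theta>\<bar> \<le> pi"
  shows "cmod (psi (cis \<theta>)) \<le> exp (- gauss_rate * \<theta>\<^sup>2)"
proof -
  define b where "b = (p1 + q) / (18 * p2)"
  have b: "b > 0" using p1_pos p2_pos q_pos by (simp add: b_def)
  define u where "u = b * \<theta>\<^sup>2"
  have u: "u \<ge> 0" using b by (simp add: u_def)
  have "p2 * (1 + u) \<le> p2 + (p1 + q) * (1 - cos \<theta>)"
  proof -
    have "p2 * u = (p1 + q) * (\<theta>\<^sup>2 / 18)" using p2_pos by (simp add: u_def b_def)
    also have "\<dots> \<le> (p1 + q) * (1 - cos \<theta>)"
      using one_minus_cos_ge[OF assms] p1_pos q_pos by (intro mult_left_mono) auto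
    finally show ?thesis by (simp add: ring_distribs)
  qed
  also note denom_cis[of \<theta>]
  finally have *: "p2 * (1 + u) \<le> cmod (1 - of_real p1 * cis \<theta> - of_real q / cis \<theta>)" .
  have "cmod (psi (cis \<theta>)) = p2 / cmod (1 - of_real p1 * cis \<theta> - of_real q / cis \<theta>)"
    using p2_pos by (simp add: psi_def norm_divide)
  also have "\<dots> \<le> p2 / (p2 * (1 + u))"
  proof (intro divide_left_mono mult_pos_pos *)
    show "0 < cmod (1 - of_real p1 * cis \<theta> - of_real q / cis \<theta>)"
      by (metis zero_less_norm_iff denom_cis_nz)
  qed (use p2_pos u in auto)
  also have "\<dots> = inverse (1 + u)" using p2_pos by (simp add: divide_inverse)
  also have "\<dots> \<le> exp (- gauss_rate * \<theta>\<^sup>2)"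
  proof -
    have "\<theta>\<^sup>2 \<le> pi\<^sup>2"
      using assms by (simp add: abs_le_square_iff[symmetric])
    then have "u \<le> b * pi\<^sup>2" using b by (simp add: u_def)
    have "gauss_rate * \<theta>\<^sup>2 = u / (1 + b * pi\<^sup>2)" by (simp add: gauss_rate_def u_def b_def)
    also have "\<dots> \<le> u / (1 + u)"
      using u \<open>u \<le> b * pi\<^sup>2\<close> by (intro divide_left_mono mult_pos_pos) auto
    also have "\<dots> = - (inverse (1 + u) - 1)"
      using u by (simp add: field_simps)
    also have "\<dots> \<le> - ln (inverse (1 + u))"
      using ln_le_minus_one[of "inverse (1 + u)"] u by simp
    finally have "ln (inverse (1 + u)) \<le> - gauss_rate * \<theta>\<^sup>2" by simp
    then show ?thesis using u
      by (metis exp_le_cancel_iff exp_ln inverse_positive_iff_positive add_pos_nonneg zero_less_one)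
  qed
  finally show ?thesis .
qed

section \<open>Expansion of the centred characteristic function at the origin\<close>

definition centred :: "real \<Rightarrow> complex" where
  "centred \<theta> = psi (cis \<theta>) * cis (- slope * \<theta>)"

lemma inverse_centred:
  "inverse (centred \<theta>) = of_real (1 / p2) * cis (slope * \<theta>)
     - of_real (p1 / p2) * cis ((slope + 1) * \<theta>) - of_real (q / p2) * cis ((slope - 1) * \<theta>)"
  using p2_pos denom_cis_nz[of \<theta>]
  by (simp add: centred_def psi_def field_simps cis_mult cis_divide ring_distribs)

lemma centred_nz: "centred \<theta> \<noteq> 0"
  using p2_pos denom_cis_nz[of \<theta>] by (simp add: centred_def psi_def)

text \<open>The reciprocal of \<open>psi\<close> is a trigonometric polynomial, so after centring
  only three Taylor remainders of \<open>cis\<close> have to be added up. The constant terms sum to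
  1, \<open>slope\<close> is the value that cancels the linear ones, and the quadratic ones give
  \<open>var\<close>.\<close>

lemma inverse_centred_taylor:
  "\<exists>C. \<forall>\<theta>. cmod (inverse (centred \<theta>) - 1 - of_real (var * \<theta>\<^sup>2 / 2)) \<le> C * \<bar>\<theta>\<bar> ^ 3"
proof -
  define T where "T u = 1 + \<i> * of_real u - complex_of_real (u\<^sup>2 / 2)" for u :: real
  define R where "R u = cis u - T u" for u
  have R: "cmod (R u) \<le> \<bar>u\<bar> ^ 3 / 6" for u
    unfolding R_def T_def by (rule cis_taylor2)
  have key: "of_real (1 / p2) * T (slope * \<theta>) - of_real (p1 / p2) * T ((slope + 1) * \<theta>)
      - of_real (q / p2) * T ((slope - 1) * \<theta>) = 1 + of_real (var * \<theta>\<^sup>2 / 2)" for \<theta>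
  proof (rule complex_eqI)
    have p: "p1 = 1 - p2 - q" using sum_one by linarith
    have sl: "slope * p2 = p1 - q" using p2_pos by (simp add: slope_def)
    have sl2: "slope\<^sup>2 * p2 = slope * (p1 - q)" using sl by (simp add: power2_eq_square)
    have "p2 * Re (of_real (1 / p2) * T (slope * \<theta>) - of_real (p1 / p2) * T ((slope + 1) * \<theta>)
      - of_real (q / p2) * T ((slope - 1) * \<theta>))
      = (1 - p1 - q) + \<theta>\<^sup>2 / 2 * (p1 * (slope + 1)\<^sup>2 + q * (slope - 1)\<^sup>2 - slope\<^sup>2)"
      using p2_pos by (simp add: T_def field_simps power2_eq_square)
    also have "p1 * (slope + 1)\<^sup>2 + q * (slope - 1)\<^sup>2 - slope\<^sup>2
        = - (slope\<^sup>2 * p2) + 2 * (slope * (p1 - q)) + (1 - p2)"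
      unfolding p by (simp add: power2_eq_square algebra_simps)
    also have "\<dots> = p2 * var"
      unfolding sl2[symmetric] var_def using p2_pos by (simp add: field_simps)
    finally have "p2 * Re (of_real (1 / p2) * T (slope * \<theta>) - of_real (p1 / p2) * T ((slope + 1) * \<theta>)
      - of_real (q / p2) * T ((slope - 1) * \<theta>)) = p2 * (1 + var * \<theta>\<^sup>2 / 2)"
      using sum_one by (simp add: algebra_simps)
    then show "Re (of_real (1 / p2) * T (slope * \<theta>) - of_real (p1 / p2) * T ((slope + 1) * \<theta>)
      - of_real (q / p2) * T ((slope - 1) * \<theta>)) = Re (1 + of_real (var * \<theta>\<^sup>2 / 2))"
      using p2_pos by simp
    have "p2 * Im (of_real (1 / p2) * T (slope * \<theta>) - of_real (p1 / p2) * T ((slope + 1) * \<theta>)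
      - of_real (q / p2) * T ((slope - 1) * \<theta>))
      = \<theta> * (slope - p1 * (slope + 1) - q * (slope - 1))"
      using p2_pos by (simp add: T_def field_simps)
    also have "slope - p1 * (slope + 1) - q * (slope - 1) = slope * p2 - (p1 - q)"
      unfolding p by (simp add: algebra_simps)
    finally show "Im (of_real (1 / p2) * T (slope * \<theta>) - of_real (p1 / p2) * T ((slope + 1) * \<theta>)
      - of_real (q / p2) * T ((slope - 1) * \<theta>)) = Im (1 + of_real (var * \<theta>\<^sup>2 / 2))"
      using p2_pos sl by simp
  qed
  define C where "C = 1 / p2 * (\<bar>slope\<bar> ^ 3 / 6) + p1 / p2 * (\<bar>slope + 1\<bar> ^ 3 / 6)
      + q / p2 * (\<bar>slope - 1\<bar> ^ 3 / 6)"
  have "cmod (inverse (centred \<theta>) - 1 - of_real (var * \<theta>\<^sup>2 / 2)) \<le> C * \<bar>\<theta>\<bar> ^ 3" for \<theta>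
  proof -
    have "inverse (centred \<theta>) - 1 - of_real (var * \<theta>\<^sup>2 / 2)
      = of_real (1 / p2) * R (slope * \<theta>) - of_real (p1 / p2) * R ((slope + 1) * \<theta>)
      - of_real (q / p2) * R ((slope - 1) * \<theta>)"
      unfolding inverse_centred R_def using key[of \<theta>] by (simp add: algebra_simps)
    also have "cmod \<dots> \<le> cmod (of_real (1 / p2) * R (slope * \<theta>))
      + cmod (of_real (p1 / p2) * R ((slope + 1) * \<theta>)) + cmod (of_real (q / p2) * R ((slope - 1) * \<theta>))"
      by (meson add_right_mono norm_triangle_ineq4 order_trans)
    also have "\<dots> = 1 / p2 * cmod (R (slope * \<theta>))
      + p1 / p2 * cmod (R ((slope + 1) * \<theta>)) + q / p2 * cmod (R ((slope - 1) * \<theta>))"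
      using p1_pos p2_pos q_pos by (simp add: norm_mult norm_divide)
    also have "\<dots> \<le> 1 / p2 * (\<bar>slope * \<theta>\<bar> ^ 3 / 6)
      + p1 / p2 * (\<bar>(slope + 1) * \<theta>\<bar> ^ 3 / 6) + q / p2 * (\<bar>(slope - 1) * \<theta>\<bar> ^ 3 / 6)"
      using p1_pos p2_pos q_pos by (intro add_mono mult_left_mono R) auto
    also have "\<dots> = C * \<bar>\<theta>\<bar> ^ 3"
      unfolding C_def abs_mult power_mult_distrib by (simp add: ring_distribs)
    finally show ?thesis .
  qed
  then show ?thesis by blast
qed

text \<open>The expansion is available for the reciprocal \<open>W\<close>, so the limit of
  \<open>n * (W - 1)\<close> comes first. It forces \<open>W\<close> to tend to 1, and
  \<open>centred - 1 = - (W - 1) / W\<close> carries the limit over.\<close>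

lemma centred_power_limit:
  fixes n :: "nat \<Rightarrow> nat"
  assumes n: "filterlim n at_top sequentially"
  shows "(\<lambda>l. centred (t / sqrt (n l)) ^ n l) \<longlonglongrightarrow> of_real (exp (- (var * t\<^sup>2 / 2)))"
proof (rule tendsto_power_exp[OF n])
  show "cmod (centred (t / sqrt (n l))) \<le> 1" for l
    using psi_bound by (simp add: centred_def norm_mult)
  show "0 \<le> var * t\<^sup>2 / 2" using var_pos by simp
  obtain C where C: "\<And>\<theta>. cmod (inverse (centred \<theta>) - 1 - of_real (var * \<theta>\<^sup>2 / 2)) \<le> C * \<bar>\<theta>\<bar> ^ 3"
    using inverse_centred_taylor by blast
  define W where "W l = inverse (centred (t / sqrt (n l)))" for l
  have npos: "eventually (\<lambda>l. n l \<ge> 1) sequentially"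
    using n filterlim_at_top by blast
  have lim3: "(\<lambda>l. C * \<bar>t\<bar> ^ 3 / sqrt (n l)) \<longlonglongrightarrow> 0"
  proof -
    have "((\<lambda>x::nat. C * \<bar>t\<bar> ^ 3 / sqrt x) \<longlonglongrightarrow> 0)"
      by real_asymp
    then show ?thesis by (rule filterlim_compose[OF _ n])
  qed
  have "(\<lambda>l. of_nat (n l) * (W l - 1) - of_real (var * t\<^sup>2 / 2)) \<longlonglongrightarrow> 0"
  proof (rule Lim_null_comparison[OF _ lim3])
    show "eventually (\<lambda>l. norm (of_nat (n l) * (W l - 1) - of_real (var * t\<^sup>2 / 2))
        \<le> C * \<bar>t\<bar> ^ 3 / sqrt (n l)) sequentially"
      using npos
    proof eventually_elim
      case (elim l)
      have "of_nat (n l) * (W l - 1) - of_real (var * t\<^sup>2 / 2)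
        = of_nat (n l) * (W l - 1 - of_real (var * (t / sqrt (n l))\<^sup>2 / 2))"
        using elim by (simp add: power_divide field_simps)
      also have "norm \<dots> \<le> n l * (C * \<bar>t / sqrt (n l)\<bar> ^ 3)"
        unfolding norm_mult W_def by (intro mult_mono C) auto
      also have "\<dots> = C * \<bar>t\<bar> ^ 3 / sqrt (n l)"
        using elim by (simp add: power_divide power3_eq_cube field_simps)
      finally show ?case .
    qed
  qed
  then have W: "(\<lambda>l. of_nat (n l) * (W l - 1)) \<longlonglongrightarrow> of_real (var * t\<^sup>2 / 2)"
    by (simp add: LIM_zero_iff)
  have "filterlim (\<lambda>l. of_nat (n l) :: complex) at_infinity sequentially"
    by (rule filterlim_compose[OF tendsto_of_nat n])
  then have "(\<lambda>l. inverse (of_nat (n l) :: complex)) \<longlonglongrightarrow> 0"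
    using tendsto_inverse_0 filterlim_compose by blast
  from tendsto_mult[OF this W] have "(\<lambda>l. inverse (of_nat (n l)) * (of_nat (n l) * (W l - 1))) \<longlonglongrightarrow> 0"
    by simp
  then have "(\<lambda>l. W l - 1) \<longlonglongrightarrow> 0"
    by (rule Lim_transform_eventually) (use npos in eventually_elim, auto)
  then have "W \<longlonglongrightarrow> 1" by (simp add: LIM_zero_iff)
  then have "(\<lambda>l. - (of_nat (n l) * (W l - 1)) / W l) \<longlonglongrightarrow> - of_real (var * t\<^sup>2 / 2) / 1"
    using W by (intro tendsto_intros) auto
  moreover have "- (of_nat (n l) * (W l - 1)) / W l = of_nat (n l) * (centred (t / sqrt (n l)) - 1)" for l
    using centred_nz by (simp add: W_def field_simps)
  ultimately show "(\<lambda>l. of_nat (n l) * (centred (t / sqrt (n l)) - 1))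
      \<longlonglongrightarrow> of_real (- (var * t\<^sup>2 / 2))"
    by simp
qed

section \<open>The local limit theorem for powers of \<open>psi\<close>\<close>

lemma psi_cis_measurable [measurable]: "(\<lambda>\<theta>. psi (cis \<theta>) :: complex) \<in> borel_measurable borel"
  by (intro borel_measurable_continuous_onI, unfold psi_def) (intro continuous_intros ballI denom_cis_nz; simp)

text \<open>On the scale \<open>t / sqrt n\<close> the Gaussian bound no longer depends on
  \<open>n\<close>, which makes it a dominating function.\<close>

lemma scaled_bound:
  fixes n :: nat
  assumes "n > 0"
  shows "indicator {-pi..pi} (t / sqrt n) * cmod (psi (cis (t / sqrt n)) ^ n) \<le> exp (- (gauss_rate * t\<^sup>2))"
proof (cases "t / sqrt n \<in> {-pi..pi}")
  case True
  then have "\<bar>t / sqrt n\<bar> \<le> pi" by auto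
  from power_mono[OF psi_gauss_bound[OF this], of n]
  have "cmod (psi (cis (t / sqrt n)) ^ n) \<le> exp (- gauss_rate * (t / sqrt n)\<^sup>2) ^ n"
    by (simp add: norm_power)
  also have "\<dots> = exp (- (gauss_rate * t\<^sup>2))"
    using assms by (simp add: power_divide flip: exp_of_nat_mult)
  finally show ?thesis using True by simp
qed auto

lemma gauss_integrable: "integrable lborel (\<lambda>t. exp (- (gauss_rate * t\<^sup>2)))"
  using integral_gaussian(1)[of "2 * gauss_rate"] gauss_rate_pos by simp

lemma integral_rescale:
  fixes f :: "real \<Rightarrow> complex" and n :: nat
  assumes "n > 0"
  shows "of_real (sqrt n) * (\<integral>\<theta>. f \<theta> \<partial>lborel) = (\<integral>t. f (t / sqrt n) \<partial>lborel)"
  using assms lborel_integral_real_affine[of "1 / sqrt n" f 0]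
  by (simp add: scaleR_conv_of_real)

text \<open>Substituting \<open>\<theta> = t / sqrt (N l)\<close> concentrates the integral at the
  origin, so \<open>G\<close> enters only through \<open>G 0\<close>. Part of the phase centres the
  power of \<open>psi\<close>; the rest, \<open>(X l - slope * N l) * t / sqrt (N l)\<close>,
  vanishes because \<open>X l\<close> stays at bounded distance from the mean. \<open>G\<close>
  makes room for the initial row and for shifts of the exponent.\<close>

lemma local_limit:
  fixes G :: "real \<Rightarrow> complex" and N :: "nat \<Rightarrow> nat" and X :: "nat \<Rightarrow> real"
  assumes N: "filterlim N at_top sequentially" and Npos: "\<And>l. N l > 0"
    and X: "\<And>l. \<bar>X l - slope * N l\<bar> \<le> D"
    and Gm [measurable]: "G \<in> borel_measurable borel" and Gb: "\<And>\<theta>. cmod (G \<theta>) \<le> A" and G0: "isCont G 0"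
  shows "(\<lambda>l. of_real (sqrt (N l)) *
      (\<integral>\<theta>. indicator {-pi..pi} \<theta> *\<^sub>R (psi (cis \<theta>) ^ N l * G \<theta> * cis (- X l * \<theta>)) \<partial>lborel))
    \<longlonglongrightarrow> of_real (sqrt (2 * pi / var)) * G 0"
proof -
  define f where "f l \<theta> = indicator {-pi..pi} \<theta> *\<^sub>R (psi (cis \<theta>) ^ N l * G \<theta> * cis (- X l * \<theta>))" for l and \<theta> :: real
  have cism [measurable]: "(\<lambda>\<theta>. cis (c * \<theta>)) \<in> borel_measurable borel" for c
    by (intro borel_measurable_continuous_onI continuous_intros)
  have [measurable]: "f l \<in> borel_measurable borel" for l
    unfolding f_def by measurable
  have A: "A \<ge> 0" using Gb[of 0] norm_ge_zero order_trans by blast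
  have zero: "(\<lambda>l. t / sqrt (N l)) \<longlonglongrightarrow> 0" for t
  proof -
    have "((\<lambda>x::nat. t / sqrt x) \<longlonglongrightarrow> 0)" by real_asymp
    then show ?thesis by (rule filterlim_compose[OF _ N])
  qed
  have "(\<lambda>l. \<integral>t. f l (t / sqrt (N l)) \<partial>lborel)
    \<longlonglongrightarrow> (\<integral>t. of_real (exp (- (var * t\<^sup>2 / 2))) * G 0 \<partial>lborel)"
  proof (rule integral_dominated_convergence[where w = "\<lambda>t. A * exp (- (gauss_rate * t\<^sup>2))"])
    show "AE t in lborel. (\<lambda>l. f l (t / sqrt (N l))) \<longlonglongrightarrow> of_real (exp (- (var * t\<^sup>2 / 2))) * G 0"
    proof (rule AE_I2)
      fix t :: real
      have "(\<lambda>l. (X l - slope * N l) * (t / sqrt (N l))) \<longlonglongrightarrow> 0"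
      proof (rule Lim_null_comparison)
        show "(\<lambda>l. D * \<bar>t / sqrt (N l)\<bar>) \<longlonglongrightarrow> 0"
          using tendsto_mult_right_zero[OF tendsto_rabs_zero[OF zero]] .
        show "\<forall>\<^sub>F l in sequentially. norm ((X l - slope * N l) * (t / sqrt (N l))) \<le> D * \<bar>t / sqrt (N l)\<bar>"
          using X by (intro always_eventually allI) (simp only: real_norm_def abs_mult, intro mult_right_mono, auto)
      qed
      then have c: "(\<lambda>l. cis (- ((X l - slope * N l) * (t / sqrt (N l))))) \<longlonglongrightarrow> cis (- 0)"
        by (intro tendsto_cis tendsto_minus)
      have "(\<lambda>l. centred (t / sqrt (N l)) ^ N l * G (t / sqrt (N l)) * cis (- ((X l - slope * N l) * (t / sqrt (N l)))))
        \<longlonglongrightarrow> of_real (exp (- (var * t\<^sup>2 / 2))) * G 0 * cis (- 0)"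
        by (intro tendsto_mult c centred_power_limit N isCont_tendsto_compose[OF G0] zero)
      then have *: "(\<lambda>l. centred (t / sqrt (N l)) ^ N l * G (t / sqrt (N l)) * cis (- ((X l - slope * N l) * (t / sqrt (N l)))))
        \<longlonglongrightarrow> of_real (exp (- (var * t\<^sup>2 / 2))) * G 0" by simp
      \<comment> \<open>For fixed \<open>t\<close> the cut-off to \<open>{-pi..pi}\<close> is
        eventually inactive.\<close>
      have "eventually (\<lambda>l. \<bar>t / sqrt (N l)\<bar> < pi) sequentially"
        using order_tendstoD(2)[OF tendsto_rabs_zero[OF zero], of pi] by simp
      then show "(\<lambda>l. f l (t / sqrt (N l))) \<longlonglongrightarrow> of_real (exp (- (var * t\<^sup>2 / 2))) * G 0"
      proof (intro Lim_transform_eventually[OF *], eventually_elim)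
        case (elim l)
        define \<theta> where "\<theta> = t / sqrt (N l)"
        have "cis (- (slope * \<theta>)) ^ N l * cis (- ((X l - slope * N l) * \<theta>)) = cis (- X l * \<theta>)"
          unfolding Complex.DeMoivre cis_mult by (simp add: algebra_simps)
        then have "centred \<theta> ^ N l * G \<theta> * cis (- ((X l - slope * N l) * \<theta>))
          = psi (cis \<theta>) ^ N l * G \<theta> * cis (- X l * \<theta>)"
          by (simp add: centred_def power_mult_distrib mult_ac)
        moreover have "\<bar>\<theta>\<bar> < pi" using elim(2) by (simp only: \<theta>_def)
        then have "\<theta> \<in> {-pi..pi}" by auto
        ultimately show ?case by (simp add: f_def flip: \<theta>_def)
      qed
    qed
    show "AE t in lborel. norm (f l (t / sqrt (N l))) \<le> A * exp (- (gauss_rate * t\<^sup>2))" for l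
    proof (rule AE_I2)
      fix t
      have "norm (f l (t / sqrt (N l))) = cmod (G (t / sqrt (N l))) *
        (indicator {-pi..pi} (t / sqrt (N l)) * cmod (psi (cis (t / sqrt (N l))) ^ N l))"
        by (simp add: f_def norm_mult)
      also have "\<dots> \<le> A * exp (- (gauss_rate * t\<^sup>2))"
        using A by (intro mult_mono Gb scaled_bound Npos) auto
      finally show "norm (f l (t / sqrt (N l))) \<le> A * exp (- (gauss_rate * t\<^sup>2))" .
    qed
  qed (use gauss_integrable in auto)
  also have "(\<integral>t. of_real (exp (- (var * t\<^sup>2 / 2))) * G 0 \<partial>lborel) = of_real (sqrt (2 * pi / var)) * G 0"
    using integral_gaussian[OF var_pos] by (simp add: integral_complex_of_real)
  finally show ?thesis
    unfolding integral_rescale[OF Npos, of l "f l" for l, symmetric] unfolding f_def .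
qed

text \<open>The bound is uniform in \<open>G\<close>, in particular in a position that enters as a
  phase. It supplies the majorant for exchanging a limit with a sum of integrals whose exponents
  vary.\<close>

lemma psi_power_integral_bound:
  "\<exists>C. \<forall>n>0. \<forall>G. (\<forall>\<theta>. cmod (G \<theta>) \<le> 1) \<longrightarrow> G \<in> borel_measurable borel \<longrightarrow>
     sqrt n * cmod (\<integral>\<theta>. indicator {-pi..pi} \<theta> *\<^sub>R (psi (cis \<theta>) ^ n * G \<theta>) \<partial>lborel) \<le> C"
proof (intro exI allI impI)
  fix n :: nat and G :: "real \<Rightarrow> complex"
  assume n: "n > 0" and G: "\<forall>\<theta>. cmod (G \<theta>) \<le> 1" and [measurable]: "G \<in> borel_measurable borel"
  define f where "f \<theta> = indicator {-pi..pi} \<theta> *\<^sub>R (psi (cis \<theta>) ^ n * G \<theta>)" for \<theta> :: real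
  have [measurable]: "f \<in> borel_measurable borel" unfolding f_def by measurable
  have b: "cmod (f (t / sqrt n)) \<le> exp (- (gauss_rate * t\<^sup>2))" for t
  proof -
    have "cmod (f (t / sqrt n)) = (indicator {-pi..pi} (t / sqrt n) * cmod (psi (cis (t / sqrt n)) ^ n)) * cmod (G (t / sqrt n))"
      by (simp add: f_def norm_mult)
    also have "\<dots> \<le> exp (- (gauss_rate * t\<^sup>2)) * 1"
      using G by (intro mult_mono scaled_bound n) auto
    finally show ?thesis by simp
  qed
  have "integrable lborel (\<lambda>t. f (t / sqrt n))"
    by (rule Bochner_Integration.integrable_bound[OF gauss_integrable]) (use b in auto)
  have "sqrt n * cmod (\<integral>\<theta>. f \<theta> \<partial>lborel) = cmod (\<integral>t. f (t / sqrt n) \<partial>lborel)"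
    unfolding integral_rescale[OF n, symmetric] by (simp add: norm_mult)
  also have "\<dots> \<le> (\<integral>t. cmod (f (t / sqrt n)) \<partial>lborel)"
    by (rule integral_norm_bound)
  also have "\<dots> \<le> (\<integral>t. exp (- (gauss_rate * t\<^sup>2)) \<partial>lborel)"
    by (intro integral_mono gauss_integrable integrable_norm b) fact
  finally show "sqrt n * cmod (\<integral>\<theta>. indicator {-pi..pi} \<theta> *\<^sub>R (psi (cis \<theta>) ^ n * G \<theta>) \<partial>lborel)
    \<le> (\<integral>t. exp (- (gauss_rate * t\<^sup>2)) \<partial>lborel)" unfolding f_def .
qed

section \<open>Harmonic functions of the killed walk and the escape probability\<close>

lemma ratio_harmonic: "p1 * ratio ^ Suc (Suc x) + p2 * ratio ^ Suc x + q * ratio ^ x = ratio ^ Suc x"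
proof -
  have "q = p1 * ratio" using p1_pos by (simp add: ratio_def)
  then have "p1 * ratio ^ Suc (Suc x) = q * ratio ^ Suc x" "q * ratio ^ x = p1 * ratio ^ Suc x"
    by simp_all
  then have "p1 * ratio ^ Suc (Suc x) + p2 * ratio ^ Suc x + q * ratio ^ x = (p1 + p2 + q) * ratio ^ Suc x"
    by (simp only: ring_distribs)
  then show ?thesis using sum_one by simp
qed

text \<open>Harmonicity and \<open>e 0 = 0\<close> force the increments of \<open>e\<close> to be
  \<open>ratio ^ x * e 1\<close>, so a non-negative \<open>e\<close> is nondecreasing, and the bound
  by \<open>ratio ^ x\<close> leaves only 0. This uniqueness identifies the escape
  probability.\<close>

lemma harmonic_zero:
  fixes e :: "nat \<Rightarrow> real"
  assumes e0: "e 0 = 0" and nn: "\<And>x. 0 \<le> e x" and le: "\<And>x. e x \<le> ratio ^ x"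
    and h: "\<And>x. e (Suc x) = p1 * e (Suc (Suc x)) + p2 * e (Suc x) + q * e x"
  shows "e x = 0"
proof -
  have d: "e (Suc x) - e x = ratio ^ x * e 1" for x
  proof (induction x)
    case (Suc x)
    have "p1 * e (Suc (Suc x)) = (p1 + q) * e (Suc x) - q * e x"
    proof -
      have "(p1 + p2 + q) * e (Suc x) = p1 * e (Suc (Suc x)) + p2 * e (Suc x) + q * e x"
        unfolding sum_one using h[of x] by simp
      then show ?thesis by (simp add: ring_distribs)
    qed
    then have "p1 * (e (Suc (Suc x)) - e (Suc x)) = q * (e (Suc x) - e x)"
      by (simp add: algebra_simps)
    then show ?case using p1_pos Suc by (simp add: ratio_def field_simps)
  qed (use e0 in simp)
  then have "e x \<le> e (Suc x)" for x
  proof -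
    have "0 \<le> ratio ^ x * e 1" using nn[of 1] ratio_pos by simp
    then show ?thesis using d[of x] by linarith
  qed
  then have "incseq e" by (rule incseq_SucI)
  have "(\<lambda>x. ratio ^ x) \<longlonglongrightarrow> 0"
    using ratio_pos ratio_less_1 by (intro LIMSEQ_power_zero) auto
  moreover have "\<exists>N. \<forall>n\<ge>N. e x \<le> ratio ^ n" for x
    using \<open>incseq e\<close> le by (meson incseqD order_trans)
  ultimately have "e x \<le> 0" for x
    using LIMSEQ_le_const by blast
  then show ?thesis using nn by (simp add: antisym)
qed

lemma expectation_walk_increment:
  fixes f :: "int \<times> int \<Rightarrow> real"
  shows "measure_pmf.expectation (walk_increment p1 p2 q) f = p1 * f (1, 0) + p2 * f (0, 1) + q * f (-1, 0)"
  unfolding walk_increment_def using p1_pos p2_pos q_pos sum_one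
  by (intro expectation_pmf_of_list3) auto

abbreviation "surv n x y \<equiv> survival (walk_increment p1 p2 q) outside_quadrant n (int x, int y)"

lemma surv_Suc_Suc:
  "surv (Suc n) (Suc x) (Suc y) = p1 * surv n (Suc (Suc x)) (Suc y) + p2 * surv n (Suc x) (Suc (Suc y))
     + q * (if x = 0 then 0 else surv n x (Suc y))"
  unfolding survival_Suc expectation_walk_increment by (auto simp: outside_quadrant_def algebra_simps)

text \<open>From the axis only an upward first step can avoid the set. This is the origin of the
  factor \<open>p2\<close> in the escape probability.\<close>

lemma surv_Suc_0:
  "surv (Suc n) x 0 = p2 * (if x = 0 then 0 else surv n x 1)"
  unfolding survival_Suc expectation_walk_increment by (auto simp: outside_quadrant_def)

text \<open>\<open>1 - ratio ^ x\<close> is harmonic, vanishes on the killing line and is at most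
  the initial value 1, so the recursion in \<open>n\<close> keeps it below the survival
  probability.\<close>

lemma surv_ge: "1 - ratio ^ Suc x \<le> surv n (Suc x) (Suc y)"
proof (induction n arbitrary: x y)
  case 0
  then show ?case using ratio_pos by (simp add: survival_0)
next
  case (Suc n)
  have *: "1 - ratio ^ x \<le> (if x = 0 then 0 else surv n x (Suc y))"
    using Suc.IH[of "x - 1" y] by (cases x) auto
  have "1 - ratio ^ Suc x = p1 * (1 - ratio ^ Suc (Suc x)) + p2 * (1 - ratio ^ Suc x) + q * (1 - ratio ^ x)"
    using ratio_harmonic[of x] sum_one by (simp add: algebra_simps)
  also have "\<dots> \<le> surv (Suc n) (Suc x) (Suc y)"
    unfolding surv_Suc_Suc using p1_pos p2_pos q_pos
    by (intro add_mono mult_left_mono * Suc.IH) auto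
  finally show ?case .
qed

text \<open>There are no downward steps, so above the axis only the horizontal coordinate
  matters.\<close>

lemma surv_indep: "surv n (Suc x) (Suc y) = surv n (Suc x) (Suc 0)"
proof (induction n arbitrary: x y)
  case (Suc n)
  have "surv n x (Suc y) = surv n x (Suc 0)" if "x \<noteq> 0"
    using Suc.IH[of "x - 1" y] that by (cases x) auto
  then show ?case
    unfolding surv_Suc_Suc using Suc.IH[of "Suc x" y] Suc.IH[of x "Suc y"] Suc.IH[of x "Suc 0"] by simp
qed (simp add: survival_0)

lemma prob_never_hits_quadrant:
  "prob_never_hits (walk_increment p1 p2 q) (int x, 0) outside_quadrant = p2 * (1 - ratio ^ x)"
proof -
  define U where "U x y = prob_never_hits (walk_increment p1 p2 q) (int x, int y) outside_quadrant" for x y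
  have lim: "(\<lambda>n. surv n x y) \<longlonglongrightarrow> U x y" for x y
    unfolding U_def by (rule survival_tendsto)
  \<comment> \<open>The value at 0 is imposed: \<open>U 0 1\<close> is positive because the start is
    exempt, whereas the recursion kills every arrival in column 0.\<close>
  define e where "e x = (if x = 0 then 0 else U x 1 - (1 - ratio ^ x))" for x
  have "e x = 0" for x
  proof (rule harmonic_zero)
    show "0 \<le> e x" for x
      using LIMSEQ_le_const[OF lim[of x 1], of "1 - ratio ^ x"] surv_ge[of "x - 1" _ 0]
      by (cases x) (auto simp: e_def)
    show "e x \<le> ratio ^ x" for x
      using LIMSEQ_le_const2[OF lim[of x 1], of 1] survival_le_1 ratio_pos by (auto simp: e_def)
    show "e (Suc x) = p1 * e (Suc (Suc x)) + p2 * e (Suc x) + q * e x" for x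
    proof -
      have "(\<lambda>n. surv (Suc n) (Suc x) (Suc 0)) \<longlonglongrightarrow> U (Suc x) (Suc 0)"
        using lim by (rule LIMSEQ_Suc)
      moreover have eq: "surv (Suc n) (Suc x) (Suc 0) = p1 * surv n (Suc (Suc x)) (Suc 0) + p2 * surv n (Suc x) (Suc 0)
         + q * (if x = 0 then 0 else surv n x (Suc 0))" for n
        unfolding surv_Suc_Suc using surv_indep[of n x "Suc 0"] by simp
      have lim': "(\<lambda>n. if x = 0 then 0 else surv n x (Suc 0)) \<longlonglongrightarrow> (if x = 0 then 0 else U x (Suc 0))"
        using lim[of x "Suc 0"] by (cases "x = 0") simp_all
      have "(\<lambda>n. surv (Suc n) (Suc x) (Suc 0)) \<longlonglongrightarrow> p1 * U (Suc (Suc x)) (Suc 0) + p2 * U (Suc x) (Suc 0)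
         + q * (if x = 0 then 0 else U x (Suc 0))"
        unfolding eq by (intro tendsto_add tendsto_mult tendsto_const lim lim')
      ultimately have "U (Suc x) (Suc 0) = p1 * U (Suc (Suc x)) (Suc 0) + p2 * U (Suc x) (Suc 0)
         + q * (if x = 0 then 0 else U x (Suc 0))"
        by (rule LIMSEQ_unique)
      moreover define R where "R y = 1 - ratio ^ y" for y
      have "R (Suc x) = p1 * R (Suc (Suc x)) + p2 * R (Suc x) + q * R x"
        using ratio_harmonic[of x] sum_one by (simp add: R_def algebra_simps)
      moreover have "e (Suc y) = U (Suc y) (Suc 0) - R (Suc y)" for y by (simp add: e_def R_def)
      moreover have "e x = (if x = 0 then 0 else U x (Suc 0)) - R x" by (simp add: e_def R_def)
      ultimately show ?thesis by (simp only: right_diff_distrib)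
    qed
  qed (simp add: e_def)
  then have U1: "x \<noteq> 0 \<Longrightarrow> U x 1 = 1 - ratio ^ x" using e_def[of x] by simp
  have "(\<lambda>n. surv (Suc n) x 0) \<longlonglongrightarrow> U x 0"
    using lim by (rule LIMSEQ_Suc)
  moreover have "(\<lambda>n. surv (Suc n) x 0) \<longlonglongrightarrow> p2 * (if x = 0 then 0 else U x 1)"
    unfolding surv_Suc_0 using lim[of x 1] by (intro tendsto_intros) simp
  ultimately have "U x 0 = p2 * (if x = 0 then 0 else U x 1)"
    by (rule LIMSEQ_unique)
  then show ?thesis using U1 by (simp add: U_def)
qed

section \<open>Covariance of an increment\<close>

lemma covariance_walk_increment:
  defines "F \<equiv> walk_increment p1 p2 q"
  shows "mean_increment F = vector [p1 - q, p2]"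
    and "covariance_matrix F $ 1 $ 1 = (1 - p2) - (p1 - q)\<^sup>2"
    and "covariance_matrix F $ 2 $ 2 = p2 - p2\<^sup>2"
    and "covariance_matrix F $ 1 $ 2 = - (p1 - q) * p2"
    and "covariance_matrix F $ 2 $ 1 = - (p1 - q) * p2"
proof -
  show m: "mean_increment F = vector [p1 - q, p2]"
    unfolding F_def using p1_pos p2_pos q_pos sum_one by (intro mean_increment_walk_increment) auto
  have p1: "p1 = 1 - p2 - q" using sum_one by linarith
  show "covariance_matrix F $ 1 $ 1 = (1 - p2) - (p1 - q)\<^sup>2"
    and "covariance_matrix F $ 2 $ 2 = p2 - p2\<^sup>2"
    and "covariance_matrix F $ 1 $ 2 = - (p1 - q) * p2"
    and "covariance_matrix F $ 2 $ 1 = - (p1 - q) * p2"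
    unfolding covariance_matrix_def m unfolding F_def
    by (simp_all add: expectation_walk_increment vec_of_pair_def)
       (simp_all add: p1 power2_eq_square algebra_simps)
qed

text \<open>The left-hand side is the variance of \<open>p2 * dx - (p1 - q) * dy\<close>, that is of
  \<open>p2 * (dx - slope * dy)\<close>, over one increment \<open>(dx, dy)\<close>. An upward step
  takes \<open>1 / p2\<close> increments on average, so by Wald's identity
  \<open>dx - slope * dy\<close> has variance \<open>p2 * var\<close>.\<close>

lemma det_quadratic_form_covariance:
  defines "F \<equiv> walk_increment p1 p2 q"
  shows "det (covariance_matrix F) * (mean_increment F \<bullet> (matrix_inv (covariance_matrix F) *v mean_increment F))
    = p2 ^ 3 * var"
proof -
  note cov = covariance_walk_increment[folded F_def]
  have p1: "p1 = 1 - p2 - q" using sum_one by linarith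
  have "det (covariance_matrix F) = 4 * p1 * p2 * q"
    unfolding det_2 cov by (simp add: p1 power2_eq_square algebra_simps)
  then have "det (covariance_matrix F) \<noteq> 0" using p1_pos p2_pos q_pos by simp
  from det_quadratic_form_inverse[OF this, of "mean_increment F"]
  have "det (covariance_matrix F) * (mean_increment F \<bullet> (matrix_inv (covariance_matrix F) *v mean_increment F))
    = p2 * (p1 - q)\<^sup>2 + p2\<^sup>2 * (1 - p2)"
    unfolding cov by (simp add: power2_eq_square algebra_simps)
  also have "\<dots> = p2 ^ 3 * var"
    using p2_pos by (simp add: var_def slope_def power2_eq_square power3_eq_cube field_simps)
  finally show ?thesis .
qed

subsection \<open>Rows of an invariant measure\<close>

context
  fixes a :: "nat \<Rightarrow> nat \<Rightarrow> real"
  assumes nonneg: "\<And>y x. a y x \<ge> 0" and zero: "\<And>y. a y 0 = 0"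
    and row_step: "\<And>y x. a (Suc y) (Suc x) = p1 * a (Suc y) x + p2 * a y (Suc x) + q * a (Suc y) (Suc (Suc x))"
    and row_summable: "\<And>y. summable (a y)"
begin

definition gen :: "nat \<Rightarrow> 'b::{real_normed_field,banach} \<Rightarrow> 'b" where
  "gen y s = (\<Sum>x. of_real (a y x) * s ^ x)"

lemma gen_summable:
  fixes s :: "'b::{real_normed_field,banach}"
  assumes "norm s \<le> 1"
  shows "summable (\<lambda>x. of_real (a y x) * s ^ x)"
proof (rule summable_comparison_test'[OF row_summable[of y], of 0])
  fix x
  show "norm (of_real (a y x) * s ^ x) \<le> a y x"
    using nonneg[of y x] assms by (simp add: norm_mult norm_power mult_left_le power_le_one)
qed

text \<open>The factor \<open>of_real q / s\<close> shifts the row to the left and also produces a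
  constant term from column 1. The killed walk does not keep that mass, hence the subtracted
  \<open>q * a (Suc y) 1\<close>.\<close>

lemma gen_step:
  fixes s :: "'b::{real_normed_field,banach}"
  assumes s: "norm s \<le> 1" and nz: "s \<noteq> 0"
  shows "(1 - of_real p1 * s - of_real q / s) * gen (Suc y) s = of_real p2 * gen y s - of_real (q * a (Suc y) 1)"
proof -
  define f where "f x = of_real (a (Suc y) x) * s ^ x" for x
  define g where "g x = of_real (a y x) * s ^ x" for x
  let ?S = "gen (Suc y) s"
  have f: "f sums ?S" and g: "g sums gen y s"
    unfolding f_def g_def gen_def by (intro summable_sums gen_summable s)+
  have f0: "f 0 = 0" "g 0 = 0" and f1: "f 1 = of_real (a (Suc y) 1) * s"
    by (simp_all add: f_def g_def zero)
  have f': "(\<lambda>x. f (Suc x)) sums ?S" and g': "(\<lambda>x. g (Suc x)) sums gen y s"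
    using f g f0 by (simp_all add: sums_Suc_iff)
  have f'': "(\<lambda>x. f (Suc (Suc x))) sums (?S - f 1)"
    unfolding One_nat_def using f' by (subst sums_Suc_iff) simp
  have eq: "f (Suc x) = of_real p1 * s * f x + of_real p2 * g (Suc x) + of_real q / s * f (Suc (Suc x))" for x
    unfolding f_def g_def by (subst row_step) (use nz in \<open>simp add: field_simps\<close>)
  have "(\<lambda>x. of_real p1 * s * f x + of_real p2 * g (Suc x) + of_real q / s * f (Suc (Suc x)))
      sums (of_real p1 * s * ?S + of_real p2 * gen y s + of_real q / s * (?S - f 1))"
    by (intro sums_add sums_mult f g' f'')
  then have "(\<lambda>x. f (Suc x)) sums (of_real p1 * s * ?S + of_real p2 * gen y s + of_real q / s * (?S - f 1))"
    unfolding eq[symmetric] .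
  with f' have "?S = of_real p1 * s * ?S + of_real p2 * gen y s + of_real q / s * (?S - f 1)"
    by (rule sums_unique2)
  then show ?thesis
    unfolding f1 using nz by (simp add: field_simps)
qed

lemma gen_Suc:
  fixes s :: "'b::{real_normed_field,banach}"
  assumes s: "norm s \<le> 1" and nz: "s \<noteq> 0" and d: "1 - of_real p1 * s - of_real q / s \<noteq> 0"
  shows "gen (Suc y) s = psi s * (gen y s - of_real (q / p2 * a (Suc y) 1))"
proof -
  have "gen (Suc y) s = (of_real p2 * gen y s - of_real (q * a (Suc y) 1)) / (1 - of_real p1 * s - of_real q / s)"
    using gen_step[OF s nz, of y] d by (metis nonzero_mult_div_cancel_left)
  also have "of_real p2 * gen y s - of_real (q * a (Suc y) 1) = of_real p2 * (gen y s - of_real (q / p2 * a (Suc y) 1))"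
    using p2_pos by (simp add: field_simps)
  finally show ?thesis by (simp add: psi_def)
qed

text \<open>In the recursion the mass killed in row \<open>j + 1\<close> is subtracted before the
  factor \<open>psi s\<close> that leads into that row, which explains the exponent
  \<open>y - j\<close>.\<close>

lemma gen_closed_form:
  fixes s :: "'b::{real_normed_field,banach}"
  assumes s: "norm s \<le> 1" and nz: "s \<noteq> 0" and d: "1 - of_real p1 * s - of_real q / s \<noteq> 0"
  shows "gen y s = psi s ^ y * gen 0 s - (\<Sum>j<y. of_real (q / p2 * a (Suc j) 1) * psi s ^ (y - j))"
proof (induction y)
  case (Suc y)
  have "(\<Sum>j<Suc y. of_real (q / p2 * a (Suc j) 1) * psi s ^ (Suc y - j))
    = psi s * ((\<Sum>j<y. of_real (q / p2 * a (Suc j) 1) * psi s ^ (y - j)) + of_real (q / p2 * a (Suc y) 1))"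
    by (simp add: ring_distribs sum_distrib_left Suc_diff_le mult_ac)
  then show ?case
    by (simp only: gen_Suc[OF s nz d] Suc.IH) (simp add: ring_distribs mult_ac)
qed simp

section \<open>Total mass killed in the first column\<close>

lemma gen_nonneg: "0 \<le> s \<Longrightarrow> s \<le> 1 \<Longrightarrow> 0 \<le> gen y (s::real)"
  using gen_summable[of s y] by (auto simp: gen_def nonneg intro!: suminf_nonneg)

lemma psi_ratio: "psi ratio = 1"
  using p1_pos p2_pos q_pos sum_one by (simp add: psi_def ratio_def field_simps)

text \<open>The point \<open>sqrt ratio\<close> minimises \<open>p1 * s + q / s\<close>, hence \<open>psi\<close>.\<close>

lemma geometric_decay:
  obtains \<eta> where "0 \<le> \<eta>" "\<eta> < 1" "\<And>y. gen y (sqrt ratio) \<le> \<eta> ^ y * gen 0 (sqrt ratio)"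
proof
  define s where "s = sqrt ratio"
  have s: "0 < s" "s < 1" using ratio_pos ratio_less_1 by (auto simp: s_def)
  have "s * s = ratio" using ratio_pos by (simp add: s_def)
  then have ss: "p1 * s * s = q" using p1_pos by (simp add: ratio_def mult.assoc)
  define D where "D = 1 - p1 * s - q / s"
  have "q / s = p1 * s" using ss s by (simp add: field_simps)
  then have D: "D = 1 - 2 * (p1 * s)" by (simp add: D_def)
  have "0 < p1 * (1 - s) * (1 - s)" using p1_pos s by simp
  also have "\<dots> = p1 + q - 2 * (p1 * s)" using ss by (simp add: algebra_simps)
  finally have "D > p2" using D sum_one by linarith
  moreover have "psi s = p2 / D" by (simp add: psi_def D_def)
  ultimately show "0 \<le> psi s" "psi s < 1" using p2_pos by auto
  show "gen y (sqrt ratio) \<le> psi s ^ y * gen 0 (sqrt ratio)" for y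
  proof (induction y)
    case (Suc y)
    have "gen (Suc y) s = psi s * (gen y s - q / p2 * a (Suc y) 1)"
      using gen_Suc[of s y] s \<open>D > p2\<close> p2_pos by (simp add: D_def)
    also have "\<dots> \<le> psi s * gen y s"
      using \<open>0 \<le> psi s\<close> nonneg[of "Suc y" 1] q_pos p2_pos by (intro mult_left_mono) auto
    also have "\<dots> \<le> psi s * (psi s ^ y * gen 0 s)"
      using Suc \<open>0 \<le> psi s\<close> by (intro mult_left_mono) (auto simp: s_def)
    finally show ?case by (simp add: s_def)
  qed simp
qed

lemma first_column_le: "a y 1 * sqrt ratio \<le> gen y (sqrt ratio)"
proof -
  have s: "0 \<le> sqrt ratio" "sqrt ratio \<le> 1" using ratio_pos ratio_less_1 by auto
  have "(\<Sum>x\<in>{1}. a y x * sqrt ratio ^ x) \<le> (\<Sum>x. a y x * sqrt ratio ^ x)"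
    using gen_summable[of "sqrt ratio" y] s by (intro sum_le_suminf) (auto simp: nonneg)
  then show ?thesis by (simp add: gen_def)
qed

lemma first_column_sums: "(\<lambda>j. q / p2 * a (Suc j) 1) sums gen 0 ratio"
proof -
  have r: "0 < ratio" "ratio < 1" using ratio_pos ratio_less_1 by auto
  have "1 - p1 * ratio - q / ratio = p2"
    using p1_pos q_pos sum_one by (simp add: ratio_def)
  then have step: "gen (Suc y) ratio = gen y ratio - q / p2 * a (Suc y) 1" for y
    using gen_Suc[of ratio y] r p2_pos psi_ratio by simp
  have partial: "(\<Sum>j<n. q / p2 * a (Suc j) 1) = gen 0 ratio - gen n ratio" for n
    by (induction n) (auto simp: step)
  obtain \<eta> where \<eta>: "0 \<le> \<eta>" "\<eta> < 1" "\<And>y. gen y (sqrt ratio) \<le> \<eta> ^ y * gen 0 (sqrt ratio)"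
    using geometric_decay by blast
  \<comment> \<open>At \<open>ratio\<close> itself \<open>psi\<close> equals 1 and gives no decay.
    Monotonicity in \<open>s\<close> transfers the geometric bound from \<open>sqrt ratio\<close>,
    so the remainder of the telescoping sum vanishes.\<close>
  have "ratio \<le> sqrt ratio"
    using r by (intro real_le_rsqrt) (simp add: power2_eq_square mult_left_le)
  then have le: "gen y ratio \<le> gen y (sqrt ratio)" for y
    unfolding gen_def using gen_summable[of ratio y] gen_summable[of "sqrt ratio" y] r
    by (intro suminf_le allI mult_left_mono power_mono) (auto simp: nonneg)
  have "(\<lambda>n. gen n ratio) \<longlonglongrightarrow> 0"
  proof (rule tendsto_sandwich[of "\<lambda>_. 0" _ _ "\<lambda>y. \<eta> ^ y * gen 0 (sqrt ratio)"])
    show "(\<lambda>y. \<eta> ^ y * gen 0 (sqrt ratio)) \<longlonglongrightarrow> 0"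
      using \<eta> by (intro tendsto_mult_left_zero LIMSEQ_power_zero) auto
    show "\<forall>\<^sub>F n in sequentially. gen n ratio \<le> \<eta> ^ n * gen 0 (sqrt ratio)"
      using le \<eta>(3) order_trans by (intro always_eventually allI) blast
  qed (use gen_nonneg r in auto)
  then have "(\<lambda>n. gen 0 ratio - gen n ratio) \<longlonglongrightarrow> gen 0 ratio - 0"
    by (intro tendsto_intros)
  then show ?thesis unfolding sums_def partial by simp
qed

text \<open>The weight \<open>sqrt (Suc j)\<close> is the price of replacing
  \<open>1 / sqrt (n - j)\<close> by \<open>1 / sqrt n\<close> in the limit along rows; the
  geometric decay of the column absorbs it.\<close>

lemma first_column_summable: "summable (\<lambda>j. a (Suc j) 1 * sqrt (real (Suc j)))"
proof -
  obtain \<eta> where \<eta>: "0 \<le> \<eta>" "\<eta> < 1" "\<And>y. gen y (sqrt ratio) \<le> \<eta> ^ y * gen 0 (sqrt ratio)"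
    using geometric_decay by blast
  define C where "C = gen 0 (sqrt ratio) / sqrt ratio"
  have C: "C \<ge> 0" unfolding C_def using ratio_pos ratio_less_1 gen_nonneg by simp
  have "summable (\<lambda>n. real (Suc n) * \<eta> ^ n)"
    using geometric_deriv_sums[of \<eta>] \<eta> sums_summable by auto
  then have "summable (\<lambda>n. C * (real (Suc n) * \<eta> ^ n))" by (rule summable_mult)
  then show ?thesis
  proof (rule summable_comparison_test'[of _ 0])
    fix n
    have "a (Suc n) 1 * sqrt ratio \<le> \<eta> ^ Suc n * gen 0 (sqrt ratio)"
      using first_column_le \<eta>(3) order_trans by blast
    then have "a (Suc n) 1 \<le> C * \<eta> ^ Suc n"
      using ratio_pos by (simp add: C_def field_simps)
    also have "\<dots> \<le> C * \<eta> ^ n"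
      using C \<eta> by (intro mult_left_mono power_decreasing) auto
    finally have "a (Suc n) 1 * sqrt (real (Suc n)) \<le> (C * \<eta> ^ n) * real (Suc n)"
      using C \<eta> by (intro mult_mono) (auto simp: real_sqrt_le_iff intro!: real_le_lsqrt simp: power2_eq_square)
    then show "norm (a (Suc n) 1 * sqrt (real (Suc n))) \<le> C * (real (Suc n) * \<eta> ^ n)"
      using nonneg[of "Suc n" 1] by (simp add: mult_ac)
  qed
qed

section \<open>Fourier inversion of the rows and their limit\<close>

lemma row_fourier:
  "of_real (2 * pi * a y x) =
     (\<integral>\<theta>. indicator {-pi..pi} \<theta> *\<^sub>R (psi (cis \<theta>) ^ y * gen 0 (cis \<theta>) * cis (- real x * \<theta>)) \<partial>lborel)
     - (\<Sum>j<y. of_real (q / p2 * a (Suc j) 1) *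
         (\<integral>\<theta>. indicator {-pi..pi} \<theta> *\<^sub>R (psi (cis \<theta>) ^ (y - j) * cis (- real x * \<theta>)) \<partial>lborel))"
proof -
  have psic: "continuous_on A (\<lambda>\<theta>. psi (cis \<theta>) :: complex)" for A
    unfolding psi_def by (intro continuous_intros ballI denom_cis_nz) simp
  have genc: "continuous_on A (\<lambda>\<theta>. gen 0 (cis \<theta>) :: complex)" for A
    unfolding gen_def using continuous_on_power_series_cis[OF nonneg row_summable]
    by (rule continuous_on_subset) simp
  have i1: "integrable lborel (\<lambda>\<theta>. indicator {-pi..pi} \<theta> *\<^sub>R
      (psi (cis \<theta>) ^ y * gen 0 (cis \<theta>) * cis (- real x * \<theta>)))"
    by (intro borel_integrable_compact continuous_intros psic genc) auto
  have i2: "integrable lborel (\<lambda>\<theta>. indicator {-pi..pi} \<theta> *\<^sub>R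
      (psi (cis \<theta>) ^ (y - j) * cis (- real x * \<theta>)))" for j
    by (intro borel_integrable_compact continuous_intros psic) auto
  have i3: "integrable lborel (\<lambda>\<theta>. of_real (q / p2 * a (Suc j) 1) * indicator {-pi..pi} \<theta> *\<^sub>R
      (psi (cis \<theta>) ^ (y - j) * cis (- real x * \<theta>)))" for j
    using i2[of j] by (intro integrable_mult_right)
  have "of_real (2 * pi * a y x) =
      (\<integral>\<theta>. indicator {-pi..pi} \<theta> *\<^sub>R (gen y (cis \<theta>) * cis (- real x * \<theta>)) \<partial>lborel)"
    unfolding gen_def using fourier_coefficient[OF nonneg row_summable] by simp
  also have "(\<lambda>\<theta>. indicator {-pi..pi} \<theta> *\<^sub>R (gen y (cis \<theta>) * cis (- real x * \<theta>)))
    = (\<lambda>\<theta>. indicator {-pi..pi} \<theta> *\<^sub>R (psi (cis \<theta>) ^ y * gen 0 (cis \<theta>) * cis (- real x * \<theta>))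
      - (\<Sum>j<y. of_real (q / p2 * a (Suc j) 1) * indicator {-pi..pi} \<theta> *\<^sub>R
          (psi (cis \<theta>) ^ (y - j) * cis (- real x * \<theta>))))"
  proof
    fix \<theta> :: real
    have "gen y (cis \<theta>) = psi (cis \<theta>) ^ y * gen 0 (cis \<theta>)
        - (\<Sum>j<y. of_real (q / p2 * a (Suc j) 1) * psi (cis \<theta>) ^ (y - j))"
      by (rule gen_closed_form) (use denom_cis_nz in auto)
    then show "indicator {-pi..pi} \<theta> *\<^sub>R (gen y (cis \<theta>) * cis (- real x * \<theta>))
      = indicator {-pi..pi} \<theta> *\<^sub>R (psi (cis \<theta>) ^ y * gen 0 (cis \<theta>) * cis (- real x * \<theta>))
      - (\<Sum>j<y. of_real (q / p2 * a (Suc j) 1) * indicator {-pi..pi} \<theta> *\<^sub>R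
          (psi (cis \<theta>) ^ (y - j) * cis (- real x * \<theta>)))"
      by (simp only: scaleR_conv_of_real left_diff_distrib right_diff_distrib sum_distrib_right sum_distrib_left mult_ac)
  qed
  also have "integral\<^sup>L lborel \<dots> =
     (\<integral>\<theta>. indicator {-pi..pi} \<theta> *\<^sub>R (psi (cis \<theta>) ^ y * gen 0 (cis \<theta>) * cis (- real x * \<theta>)) \<partial>lborel)
     - (\<Sum>j<y. of_real (q / p2 * a (Suc j) 1) *
         (\<integral>\<theta>. indicator {-pi..pi} \<theta> *\<^sub>R (psi (cis \<theta>) ^ (y - j) * cis (- real x * \<theta>)) \<partial>lborel))"
    by (subst Bochner_Integration.integral_diff[OF i1 Bochner_Integration.integrable_sum[OF i3]],
        subst Bochner_Integration.integral_sum[OF i3], subst Bochner_Integration.integral_mult_right[OF i2]) auto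
  finally show ?thesis .
qed

lemma psi_one: "psi 1 = (1 :: complex)"
proof -
  have "1 - of_real p1 * 1 - of_real q / 1 = complex_of_real p2"
    using sum_one by (simp add: complex_eq_iff)
  then show ?thesis using p2_pos by (simp add: psi_def)
qed

text \<open>With \<open>k = n - j \<ge> 1\<close> one has
  \<open>k * (j + 1) - n = (k - 1) * j\<close>. A bound of order \<open>1 / sqrt (n - j)\<close>
  thus becomes one of order \<open>1 / sqrt n\<close>, with a factor that depends on
  \<open>j\<close> alone.\<close>

lemma power_split_bound:
  fixes j n :: nat
  assumes "j < n"
  shows "sqrt (real n) \<le> sqrt (real (n - j)) * sqrt (real (Suc j))"
proof -
  obtain m where m: "n = j + Suc m" using assms less_iff_Suc_add by auto
  have "real n \<le> real (n - j) * real (Suc j)"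
    unfolding m by (simp add: algebra_simps)
  then show ?thesis by (simp only: flip: real_sqrt_mult) (simp only: real_sqrt_le_iff)
qed

text \<open>For fixed \<open>j\<close> the integral with exponent \<open>N l - j\<close> has the
  same scaled limit as the one with exponent \<open>N l\<close>, because the missing factor
  \<open>psi ^ j\<close> is 1 at the origin. So every unit of killed mass cancels a unit of initial
  mass, and Tannery's theorem adds up the infinitely many \<open>j\<close>.\<close>

lemma rows_limit_positive:
  fixes N X :: "nat \<Rightarrow> nat"
  assumes N: "filterlim N at_top sequentially" and Npos: "\<And>l. N l > 0"
    and X: "\<And>l. \<bar>real (X l) - slope * N l\<bar> \<le> D"
  shows "(\<lambda>l. sqrt (N l) * a (N l) (X l)) \<longlonglongrightarrow> (gen 0 1 - gen 0 ratio) / sqrt (2 * pi * var)"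
proof -
  define J where "J l j = (\<integral>\<theta>. indicator {-pi..pi} \<theta> *\<^sub>R (psi (cis \<theta>) ^ (N l - j) * cis (- real (X l) * \<theta>)) \<partial>lborel)" for l j
  \<comment> \<open>Padding with 0 from \<open>j = N l\<close> on turns the finite sum into a series
    whose index set does not depend on \<open>l\<close>, the form that Tannery's theorem
    needs.\<close>
  define T where "T j l = (if j < N l then of_real (q / p2 * a (Suc j) 1) * (of_real (sqrt (N l)) * J l j) else 0)" for j l
  define L where "L = complex_of_real (sqrt (2 * pi / var))"
  have psi_nz: "psi (cis \<theta>) \<noteq> 0" for \<theta>
    using p2_pos denom_cis_nz[of \<theta>] by (simp add: psi_def)
  have inv_psi: "inverse (psi (cis \<theta>)) = (1 - of_real p1 * cis \<theta> - of_real q / cis \<theta>) / of_real p2" for \<theta>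
    by (simp add: psi_def)
  have ipc: "continuous_on UNIV (\<lambda>\<theta>. inverse (psi (cis \<theta>)) :: complex)"
    unfolding inv_psi using p2_pos by (intro continuous_intros) auto
  have ipb: "cmod (inverse (psi (cis \<theta>))) \<le> (1 + p1 + q) / p2" for \<theta>
  proof -
    have "cmod (1 - of_real p1 * cis \<theta> - of_real q / cis \<theta>)
        \<le> cmod 1 + cmod (of_real p1 * cis \<theta>) + cmod (of_real q / cis \<theta>)"
      by (meson add_right_mono norm_triangle_ineq4 order_trans)
    also have "\<dots> = 1 + p1 + q"
      using p1_pos q_pos by (simp add: norm_mult norm_divide)
    finally have *: "cmod (1 - of_real p1 * cis \<theta> - of_real q / cis \<theta>) \<le> 1 + p1 + q" .
    have "cmod (inverse (psi (cis \<theta>))) = cmod (1 - of_real p1 * cis \<theta> - of_real q / cis \<theta>) / p2"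
      unfolding inv_psi norm_divide using p2_pos by simp
    with * show ?thesis using p2_pos by (simp only:) (intro divide_right_mono, auto)
  qed
  have Tlim: "T j \<longlonglongrightarrow> L * of_real (q / p2 * a (Suc j) 1)" for j
  proof -
    \<comment> \<open>\<open>psi\<close> has no zero on the circle and its reciprocal is a
      trigonometric polynomial, so \<open>G\<close> is continuous and bounded, as
      \<open>local_limit\<close> demands.\<close>
    define G where "G \<theta> = inverse (psi (cis \<theta>)) ^ j" for \<theta> :: real
    have Gc: "continuous_on UNIV G" unfolding G_def by (intro continuous_intros ipc)
    have "(\<lambda>l. of_real (sqrt (N l)) *
        (\<integral>\<theta>. indicator {-pi..pi} \<theta> *\<^sub>R (psi (cis \<theta>) ^ N l * G \<theta> * cis (- real (X l) * \<theta>)) \<partial>lborel))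
      \<longlonglongrightarrow> L * G 0"
      unfolding L_def
    proof (rule local_limit[OF N Npos X])
      show "G \<in> borel_measurable borel" using Gc by (rule borel_measurable_continuous_onI)
      show "isCont G 0" using Gc by (simp add: continuous_on_eq_continuous_at)
      show "cmod (G \<theta>) \<le> ((1 + p1 + q) / p2) ^ j" for \<theta>
        unfolding G_def norm_power by (intro power_mono ipb) auto
    qed
    moreover have "G 0 = 1" by (simp add: G_def psi_one)
    ultimately have *: "(\<lambda>l. of_real (q / p2 * a (Suc j) 1) * (of_real (sqrt (N l)) *
        (\<integral>\<theta>. indicator {-pi..pi} \<theta> *\<^sub>R (psi (cis \<theta>) ^ N l * G \<theta> * cis (- real (X l) * \<theta>)) \<partial>lborel)))
      \<longlonglongrightarrow> of_real (q / p2 * a (Suc j) 1) * L"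
      by (intro tendsto_mult tendsto_const) simp
    have "eventually (\<lambda>l. N l \<ge> Suc j) sequentially"
      using N filterlim_at_top by blast
    then have "T j \<longlonglongrightarrow> of_real (q / p2 * a (Suc j) 1) * L"
    proof (intro Lim_transform_eventually[OF *], eventually_elim)
      case (elim l)
      have "psi (cis \<theta>) ^ N l * G \<theta> = psi (cis \<theta>) ^ (N l - j)" for \<theta>
        using elim psi_nz[of \<theta>] by (simp add: G_def power_diff power_inverse divide_inverse)
      then show ?case using elim by (simp add: T_def J_def)
    qed
    then show ?thesis by (simp only: mult.commute)
  qed
  obtain C where C: "\<And>n G. n > 0 \<Longrightarrow> (\<And>\<theta>. cmod (G \<theta>) \<le> 1) \<Longrightarrow> G \<in> borel_measurable borel \<Longrightarrow>
     sqrt n * cmod (\<integral>\<theta>. indicator {-pi..pi} \<theta> *\<^sub>R (psi (cis \<theta>) ^ n * G \<theta>) \<partial>lborel) \<le> C"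
    using psi_power_integral_bound by blast
  define M where "M j = q / p2 * C * (a (Suc j) 1 * sqrt (real (Suc j)))" for j
  have "summable M" unfolding M_def by (intro summable_mult first_column_summable)
  have Tbound: "norm (T j l) \<le> M j" for j l
  proof -
    have aj: "0 \<le> q / p2 * a (Suc j) 1" using q_pos p2_pos nonneg[of "Suc j" 1] by simp
    have C1: "sqrt n * cmod (\<integral>\<theta>. indicator {-pi..pi} \<theta> *\<^sub>R (psi (cis \<theta>) ^ n * cis (- real (X l) * \<theta>)) \<partial>lborel) \<le> C"
      if "n > 0" for n :: nat
      by (rule C[OF that]) (auto intro!: borel_measurable_continuous_onI continuous_intros)
    have "0 \<le> sqrt (1::nat) * cmod (\<integral>\<theta>. indicator {-pi..pi} \<theta> *\<^sub>R (psi (cis \<theta>) ^ 1 * cis (- real (X l) * \<theta>)) \<partial>lborel)"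
      by (intro mult_nonneg_nonneg) auto
    also have "\<dots> \<le> C" using C1[of 1] by simp
    finally have "C \<ge> 0" .
    show ?thesis
    proof (cases "j < N l")
      case True
      have "T j l = of_real (q / p2 * a (Suc j) 1) * (of_real (sqrt (N l)) * J l j)"
        using True by (simp only: T_def if_True)
      then have "norm (T j l) = q / p2 * a (Suc j) 1 * (sqrt (N l) * cmod (J l j))"
        by (simp only: norm_mult norm_of_real abs_of_nonneg[OF aj]) simp
      moreover have "sqrt (N l) * cmod (J l j) \<le> C * sqrt (real (Suc j))"
      proof -
        have "sqrt (N l) * cmod (J l j) \<le> (sqrt (real (N l - j)) * sqrt (real (Suc j))) * cmod (J l j)"
          by (intro mult_right_mono power_split_bound True) auto
        also have "\<dots> = (sqrt (real (N l - j)) * cmod (J l j)) * sqrt (real (Suc j))"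
          by (simp add: mult_ac)
        also have "\<dots> \<le> C * sqrt (real (Suc j))"
          unfolding J_def using True by (intro mult_right_mono C1) auto
        finally show ?thesis .
      qed
      ultimately have "norm (T j l) \<le> q / p2 * a (Suc j) 1 * (C * sqrt (real (Suc j)))"
        using mult_left_mono[OF _ aj] by metis
      then show ?thesis unfolding M_def by (simp only: mult_ac)
    next
      case False
      have "0 \<le> q / p2 * a (Suc j) 1 * (C * sqrt (real (Suc j)))"
        using \<open>C \<ge> 0\<close> by (intro mult_nonneg_nonneg[OF aj]) auto
      then have "0 \<le> M j" unfolding M_def by (simp only: mult_ac)
      then show ?thesis using False by (simp add: T_def)
    qed
  qed
  have ev: "eventually (\<lambda>(j, l). norm (T j l) \<le> M j) (at_top \<times>\<^sub>F sequentially)"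
    using Tbound by (intro always_eventually) auto
  have tann: "(\<lambda>l. \<Sum>j. T j l) \<longlonglongrightarrow> (\<Sum>j. L * of_real (q / p2 * a (Suc j) 1))"
    using tannerys_theorem[OF Tlim ev \<open>summable M\<close> sequentially_bot] by blast
  have "(\<lambda>j. L * of_real (q / p2 * a (Suc j) 1)) sums (L * of_real (gen 0 ratio))"
    by (intro sums_mult sums_of_real first_column_sums)
  then have "(\<Sum>j. L * of_real (q / p2 * a (Suc j) 1)) = L * of_real (gen 0 ratio)"
    by (rule sums_unique[symmetric])
  moreover have "(\<Sum>j. T j l) = (\<Sum>j<N l. T j l)" for l
    by (rule suminf_finite) (auto simp: T_def)
  ultimately have second: "(\<lambda>l. \<Sum>j<N l. T j l) \<longlonglongrightarrow> L * of_real (gen 0 ratio)"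
    using tann by simp
  have gc: "continuous_on UNIV (\<lambda>\<theta>. gen 0 (cis \<theta>) :: complex)"
    unfolding gen_def by (rule continuous_on_power_series_cis[OF nonneg row_summable])
  have first: "(\<lambda>l. of_real (sqrt (N l)) *
      (\<integral>\<theta>. indicator {-pi..pi} \<theta> *\<^sub>R (psi (cis \<theta>) ^ N l * gen 0 (cis \<theta>) * cis (- real (X l) * \<theta>)) \<partial>lborel))
      \<longlonglongrightarrow> L * gen 0 (cis 0)"
    unfolding L_def
  proof (rule local_limit[OF N Npos X])
    show "(\<lambda>\<theta>. gen 0 (cis \<theta>) :: complex) \<in> borel_measurable borel" using gc by (rule borel_measurable_continuous_onI)
    show "isCont (\<lambda>\<theta>. gen 0 (cis \<theta>) :: complex) 0" using gc by (simp add: continuous_on_eq_continuous_at)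
    show "cmod (gen 0 (cis \<theta>)) \<le> (\<Sum>x. a 0 x)" for \<theta>
    proof -
      have "cmod (gen 0 (cis \<theta>)) \<le> (\<Sum>x. cmod (of_real (a 0 x) * cis \<theta> ^ x))"
        unfolding gen_def using row_summable[of 0] nonneg
        by (intro summable_norm) (simp add: norm_mult norm_power)
      then show ?thesis using nonneg by (simp add: norm_mult norm_power)
    qed
  qed
  have g1: "gen 0 (cis 0) = complex_of_real (gen 0 1)"
    using row_summable[of 0] by (simp add: gen_def suminf_of_real)
  have "(\<lambda>l. of_real (sqrt (N l)) *
      (\<integral>\<theta>. indicator {-pi..pi} \<theta> *\<^sub>R (psi (cis \<theta>) ^ N l * gen 0 (cis \<theta>) * cis (- real (X l) * \<theta>)) \<partial>lborel)
      - (\<Sum>j<N l. T j l)) \<longlonglongrightarrow> L * of_real (gen 0 1) - L * of_real (gen 0 ratio)"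
    using tendsto_diff[OF first second] unfolding g1 .
  moreover have "of_real (sqrt (N l)) *
      (\<integral>\<theta>. indicator {-pi..pi} \<theta> *\<^sub>R (psi (cis \<theta>) ^ N l * gen 0 (cis \<theta>) * cis (- real (X l) * \<theta>)) \<partial>lborel)
      - (\<Sum>j<N l. T j l) = of_real (2 * pi * (sqrt (N l) * a (N l) (X l)))" for l
  proof -
    have "of_real (2 * pi * (sqrt (N l) * a (N l) (X l))) = of_real (sqrt (N l)) * complex_of_real (2 * pi * a (N l) (X l))"
      by simp
    also have "\<dots> = of_real (sqrt (N l)) *
      (\<integral>\<theta>. indicator {-pi..pi} \<theta> *\<^sub>R (psi (cis \<theta>) ^ N l * gen 0 (cis \<theta>) * cis (- real (X l) * \<theta>)) \<partial>lborel)
      - (\<Sum>j<N l. T j l)"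
      unfolding row_fourier right_diff_distrib sum_distrib_left T_def J_def
      by (simp add: mult_ac)
    finally show ?thesis by simp
  qed
  ultimately have "(\<lambda>l. complex_of_real (2 * pi * (sqrt (N l) * a (N l) (X l))))
      \<longlonglongrightarrow> of_real (sqrt (2 * pi / var) * (gen 0 1 - gen 0 ratio))"
    by (simp add: L_def right_diff_distrib)
  then have "(\<lambda>l. 2 * pi * (sqrt (N l) * a (N l) (X l))) \<longlonglongrightarrow> sqrt (2 * pi / var) * (gen 0 1 - gen 0 ratio)"
    by (simp only: tendsto_of_real_iff)
  then have "(\<lambda>l. 1 / (2 * pi) * (2 * pi * (sqrt (N l) * a (N l) (X l))))
      \<longlonglongrightarrow> 1 / (2 * pi) * (sqrt (2 * pi / var) * (gen 0 1 - gen 0 ratio))"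
    by (rule tendsto_mult_left)
  moreover have "1 / (2 * pi) * (2 * pi * z) = z" for z
    by simp
  moreover have "1 / (2 * pi) * (sqrt (2 * pi / var) * z) = z / sqrt (2 * pi * var)" for z
  proof -
    define u v where "u = sqrt (2 * pi / var)" and "v = sqrt (2 * pi * var)"
    have "2 * pi / var * (2 * pi * var) = (2 * pi)\<^sup>2"
      using var_pos by (simp add: power2_eq_square)
    moreover have "u * v = sqrt (2 * pi / var * (2 * pi * var))"
      unfolding u_def v_def by (rule real_sqrt_mult[symmetric])
    ultimately have uv: "u * v = 2 * pi"
      by (simp only: real_sqrt_abs) simp
    have "u > 0" "v > 0" using var_pos by (auto simp: u_def v_def)
    then have "1 / (u * v) * (u * z) = z / v" by simp
    then show ?thesis unfolding uv unfolding u_def v_def .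
  qed
  ultimately show ?thesis by (simp only:)
qed

lemma rows_limit:
  fixes N X :: "nat \<Rightarrow> nat"
  assumes N: "filterlim N at_top sequentially"
    and X: "eventually (\<lambda>l. \<bar>real (X l) - slope * N l\<bar> \<le> D) sequentially"
  shows "(\<lambda>l. sqrt (N l) * a (N l) (X l)) \<longlonglongrightarrow> (\<Sum>x. a 0 x * (1 - ratio ^ x)) / sqrt (2 * pi * var)"
proof -
  have "eventually (\<lambda>l. N l \<ge> 1) sequentially"
    using N filterlim_at_top by blast
  with X have "eventually (\<lambda>l. N l \<ge> 1 \<and> \<bar>real (X l) - slope * N l\<bar> \<le> D) sequentially"
    by eventually_elim simp
  then obtain k where k: "\<And>l. l \<ge> k \<Longrightarrow> N l \<ge> 1 \<and> \<bar>real (X l) - slope * N l\<bar> \<le> D"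
    by (auto simp: eventually_sequentially)
  \<comment> \<open>The shift by \<open>k\<close> discards the finitely many \<open>l\<close> at
    which positivity or the distance bound may fail.\<close>
  have "(\<lambda>l. sqrt (N (l + k)) * a (N (l + k)) (X (l + k))) \<longlonglongrightarrow> (gen 0 1 - gen 0 ratio) / sqrt (2 * pi * var)"
  proof (rule rows_limit_positive)
    show "filterlim (\<lambda>l. N (l + k)) at_top sequentially"
      using filterlim_compose[OF N filterlim_add_const_nat_at_top] .
    show "N (l + k) > 0" for l using k[of "l + k"] by simp
    show "\<bar>real (X (l + k)) - slope * N (l + k)\<bar> \<le> D" for l using k[of "l + k"] by simp
  qed
  then have "(\<lambda>l. sqrt (N l) * a (N l) (X l)) \<longlonglongrightarrow> (gen 0 1 - gen 0 ratio) / sqrt (2 * pi * var)"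
    by (rule LIMSEQ_offset)
  moreover have "gen 0 1 - gen 0 ratio = (\<Sum>x. a 0 x * (1 - ratio ^ x))"
    using gen_summable[of "1::real" 0] gen_summable[of ratio 0] ratio_pos ratio_less_1
    by (simp add: gen_def suminf_diff right_diff_distrib)
  ultimately show ?thesis by simp
qed

end

subsection \<open>Stationary measures of the polling model\<close>

context
  fixes l1 l2 m :: real and p :: "state pmf"
  assumes l1_pos: "l1 > 0" and l2_pos: "l2 > 0" and m_pos: "m > 0"
    and rates: "l1 + l2 + m = 1" and stable: "l1 + l2 < m"
    and stat: "stationary_on polling_states (polling_kernel l1 l2 m) p"
    and p1: "p1 = l1 * m / (l1 + l2)" and p2: "p2 = l2 * m / (l1 + l2)" and q: "q = l1 + l2"
begin

text \<open>This is \<open>1 / \<rho>\<close>. Away from the empty state every transition changes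
  the level by one, so \<open>gain ^ level\<close> is harmonic there: conjugating with it turns the
  rates \<open>l1\<close>, \<open>l2\<close>, \<open>m\<close> into \<open>l1 * gain = p1\<close>,
  \<open>l2 * gain = p2\<close>, \<open>m / gain = q\<close>, which again sum to 1.\<close>

definition gain :: real where "gain = m / (l1 + l2)"

lemma gain_pos: "gain > 0" and gain_gt_1: "gain > 1"
  using l1_pos l2_pos m_pos stable by (auto simp: gain_def)

definition step :: "(state \<Rightarrow> real) \<Rightarrow> state \<Rightarrow> real" where
  "step f = (\<lambda>(x, y, s).
     if (x, y, s) = (0, 0, 1) then l1 * f (1, 0, 1) + l2 * f (0, 1, 2) + m * f (0, 0, 1)
     else l1 * f (x + 1, y, s) + l2 * f (x, y + 1, s) + m * f (service (x, y, s)))"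

lemma expectation_kernel: "measure_pmf.expectation (polling_kernel l1 l2 m z) f = step f z"
proof (cases z)
  case (fields x y s)
  show ?thesis
    using l1_pos l2_pos m_pos rates unfolding fields polling_kernel_def step_def
    by (simp add: expectation_pmf_of_list3)
qed

lemma expectation_step:
  assumes "\<And>z. 0 \<le> f z" "\<And>z. f z \<le> B"
  shows "measure_pmf.expectation p f = measure_pmf.expectation p (step f)"
  using stationary_expectation[OF stat assms] unfolding expectation_kernel .

lemma integrable_step:
  assumes "\<And>z. 0 \<le> f z" "\<And>z. f z \<le> B"
  shows "integrable p (step f)"
proof (rule measure_pmf.integrable_const_bound[where B = B])
  have "0 \<le> step f z" "step f z \<le> B" for z
    unfolding expectation_kernel[symmetric]
    by (rule expectation_bounded[where B = B]; use assms in simp)+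
  then show "AE z in p. norm (step f z) \<le> B"
    by (intro AE_I2) simp
qed simp

lemma AE_states: "AE z in p. z \<in> polling_states"
  using stat by (auto simp: AE_measure_pmf_iff stationary_on_def)

lemma pmf_eq_0: "z \<notin> polling_states \<Longrightarrow> pmf p z = 0"
  using stat by (auto simp: stationary_on_def set_pmf_iff)

lemma expectation_indicator_singleton: "measure_pmf.expectation p (indicator {z}) = pmf p z"
  by (simp add: pmf.rep_eq)

lemma integrable_indicator_pmf [simp]: "integrable (measure_pmf p) (indicator A :: _ \<Rightarrow> real)"
  by (rule measure_pmf.integrable_const_bound[where B = 1]) (auto simp: indicator_def)

text \<open>A switch back to sheet 1 lands on \<open>y = 0\<close>, so points with
  \<open>y \<ge> 1\<close> receive mass only from within the sheet, as in a free walk. At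
  \<open>x = 1\<close> the left neighbour is not a state and has mass 0.\<close>

lemma balance:
  assumes "x \<ge> 1" "y \<ge> 1"
  shows "pmf p (x, y, 1) = l1 * pmf p (x - 1, y, 1) + l2 * pmf p (x, y - 1, 1) + m * pmf p (x + 1, y, 1)"
proof -
  have "pmf p (x, y, 1) = measure_pmf.expectation p (step (indicator {(x, y, 1)}))"
    unfolding expectation_indicator_singleton[symmetric]
    by (rule expectation_step[where B = 1]) (auto simp: indicator_def)
  also have "\<dots> = measure_pmf.expectation p (\<lambda>z. l1 * indicator {(x - 1, y, 1)} z
      + l2 * indicator {(x, y - 1, 1)} z + m * indicator {(x + 1, y, 1)} z)"
  proof (intro integral_cong_AE)
    show "AE z in p. step (indicator {(x, y, 1)}) z = l1 * indicator {(x - 1, y, 1)} z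
      + l2 * indicator {(x, y - 1, 1)} z + m * indicator {(x + 1, y, 1)} z"
      using AE_states
    proof eventually_elim
      case (elim z)
      then show ?case
        using assms by (cases z) (auto simp: step_def service_def polling_states_def indicator_def)
    qed
  qed auto
  also have "\<dots> = l1 * pmf p (x - 1, y, 1) + l2 * pmf p (x, y - 1, 1) + m * pmf p (x + 1, y, 1)"
    by (simp add: measure_pmf_single)
  finally show ?thesis .
qed

section \<open>The total queue length\<close>

lemma level_up:
  assumes "(x, y, s) \<in> polling_states"
  shows "level (x + 1, y, s) = Suc (level (x, y, s))" "level (x, y + 1, s) = Suc (level (x, y, s))"
  using assms by (auto simp: polling_states_def level_def nat_add_distrib)

lemma level_service:
  assumes "(x, y, s) \<in> polling_states" "(x, y, s) \<noteq> (0, 0, 1)"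
  shows "level (x, y, s) = Suc (level (service (x, y, s)))"
  using assms by (auto simp: polling_states_def level_def service_def Suc_nat_eq_nat_zadd1)

lemma level_eq_0: "z \<in> polling_states \<Longrightarrow> level z = 0 \<longleftrightarrow> z = (0, 0, 1)"
  by (auto simp: polling_states_def level_def)

text \<open>The level is a birth and death chain whichever queue is served, because the server works
  whenever the system is not empty. Testing stationarity on the levels up to \<open>n\<close> gives
  the cut equation between \<open>n\<close> and \<open>n + 1\<close>.\<close>

lemma level_prob_Suc:
  "m * measure p {z. level z = Suc n} = (l1 + l2) * measure p {z. level z = n}"
proof -
  define f :: "state \<Rightarrow> real" where "f = indicator {z. level z \<le> n}"
  define g :: "state \<Rightarrow> real" where
    "g z = f z - (l1 + l2) * indicator {z. level z = n} z + m * indicator {z. level z = Suc n} z" for z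
  have [simp]: "integrable p f" by (simp add: f_def)
  have "measure_pmf.expectation p f = measure_pmf.expectation p (step f)"
    by (rule expectation_step[where B = 1]) (auto simp: f_def)
  also have "\<dots> = measure_pmf.expectation p g"
  proof (intro integral_cong_AE)
    show "AE z in p. step f z = g z"
      using AE_states
    proof eventually_elim
      case (elim z)
      obtain x y s where z: "z = (x, y, s)" by (cases z)
      show ?case
      proof (cases "z = (0, 0, 1)")
        case True
        then show ?thesis using rates
          by (simp add: step_def g_def f_def level_def indicator_def algebra_simps)
      next
        case False
        note up = level_up[OF elim[unfolded z]] and dn = level_service[OF elim[unfolded z] False[unfolded z]]
        have "step f z = (l1 + l2) * of_bool (Suc (level z) \<le> n) + m * of_bool (level (service z) \<le> n)"
        proof -
          have "step f z = l1 * f (x + 1, y, s) + l2 * f (x, y + 1, s) + m * f (service (x, y, s))"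
            unfolding z step_def by (simp only: prod.case if_not_P[OF False[unfolded z]])
          then show ?thesis
            using up by (simp add: z f_def indicator_def ring_distribs)
        qed
        also have "level (service z) \<le> n \<longleftrightarrow> level z \<le> Suc n"
          using dn z by simp
        also have "(l1 + l2) * of_bool (Suc (level z) \<le> n) + m * of_bool (level z \<le> Suc n) = g z"
          using rates by (cases "level z" n rule: linorder_cases)
            (auto simp: g_def f_def indicator_def le_Suc_eq not_le Suc_le_eq)
        finally show ?thesis .
      qed
    qed
  qed auto
  also have "\<dots> = measure_pmf.expectation p f - (l1 + l2) * measure p {z. level z = n}
      + m * measure p {z. level z = Suc n}"
    unfolding g_def by simp
  finally show ?thesis by simp
qed

lemma level_prob: "gain ^ n * measure p {z. level z = n} = measure p {z. level z = 0}"
proof (induction n)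
  case (Suc n)
  have "gain * measure p {z. level z = Suc n} = measure p {z. level z = n}"
    using level_prob_Suc[of n] l1_pos l2_pos by (simp add: gain_def field_simps)
  then have "gain ^ Suc n * measure p {z. level z = Suc n} = gain ^ n * measure p {z. level z = n}"
    by (simp add: mult.assoc mult.left_commute)
  then show ?case using Suc by simp
qed simp

text \<open>Level 0 is the empty state alone and its mass determines that of every level, so in a
  probability measure it cannot be 0.\<close>

lemma pmf_empty_pos: "pmf p (0, 0, 1) > 0"
proof (rule ccontr)
  assume "\<not> pmf p (0, 0, 1) > 0"
  then have "pmf p (0, 0, 1) = 0" using pmf_nonneg[of p "(0, 0, 1)"] by linarith
  then have 0: "(0, 0, 1) \<notin> set_pmf p" by (simp add: set_pmf_iff)
  have "measure p {z. level z = 0} = 0"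
    unfolding measure_pmf_zero_iff using 0 stat level_eq_0 by (auto simp: stationary_on_def)
  then have all: "measure p {z. level z = n} = 0" for n
    using level_prob[of n] gain_pos by simp
  obtain z where z: "z \<in> set_pmf p" using set_pmf_not_empty[of p] by blast
  with all[of "level z"] show False
    unfolding measure_pmf_zero_iff by auto
qed

text \<open>The boundary sum has weight 0 at \<open>x = 0\<close>, so its positivity is taken from
  \<open>x = 1\<close>; one arrival at the empty system puts mass there.\<close>

lemma pmf_one_pos: "pmf p (1, 0, 1) > 0"
proof -
  let ?z = "(1, 0, 1) :: state"
  have "0 < l1 * pmf p (0, 0, 1)" using pmf_empty_pos l1_pos by simp
  also have "\<dots> = measure_pmf.expectation p (\<lambda>z. l1 * indicator {(0, 0, 1)} z)"
    by (simp add: measure_pmf_single)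
  also have "\<dots> \<le> measure_pmf.expectation p (step (indicator {?z}))"
  proof (rule integral_mono)
    show "integrable p (step (indicator {?z}))"
      by (rule integrable_step[where B = 1]) (auto simp: indicator_def)
    show "l1 * indicator {(0, 0, 1)} z \<le> step (indicator {?z}) z" for z
      using l1_pos l2_pos m_pos by (cases z) (auto simp: step_def indicator_def)
  qed auto
  also have "\<dots> = pmf p ?z"
    unfolding expectation_indicator_singleton[symmetric]
    by (rule expectation_step[where B = 1, symmetric]) (auto simp: indicator_def)
  finally show ?thesis .
qed

section \<open>Twisted rates and the Lyapunov function\<close>

lemma p1_gain: "p1 = l1 * gain" and p2_gain: "p2 = l2 * gain"
  by (simp_all add: p1 p2 gain_def)

lemma m_gain: "q * gain = m"
  using l1_pos l2_pos by (simp add: q gain_def)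

text \<open>
  \<open>ratio ^ x\<close> is the probability of switching to sheet 2 again, so without the \<open>of_bool\<close> term this is a
  superharmonic function that drops at each switch back to sheet 1. The extra \<open>1 - ratio\<close> on the rows
  up to \<open>k\<close> is as large as this drop allows, and is lost by each upward step out of row \<open>k\<close>.
\<close>

definition pot :: "nat \<Rightarrow> state \<Rightarrow> real" where
  "pot k = (\<lambda>(x, y, s).
     if s = 1 \<and> x \<ge> 1 then ratio ^ nat x + (1 - ratio) * of_bool (y \<le> int k) else 1)"

lemma pot_le_1: "pot k z \<le> 1" and pot_nonneg: "0 \<le> pot k z"
proof -
  obtain x y s where z: "z = (x, y, s)" by (cases z)
  have "ratio ^ nat x \<le> ratio ^ 1" if "x \<ge> 1"
    using that ratio_pos ratio_less_1 by (intro power_decreasing) auto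
  then show "pot k z \<le> 1" "0 \<le> pot k z"
    using ratio_pos ratio_less_1 by (auto simp: z pot_def)
qed

text \<open>On sheet 1 this is \<open>ratio_harmonic\<close> together with the loss on leaving row
  \<open>k\<close>; on sheet 2 the potential has its maximal value 1, so no transition can raise
  it.\<close>

lemma pot_drift:
  assumes z: "(x, y, s) \<in> polling_states" "(x, y, s) \<noteq> (0, 0, 1)"
  shows "p1 * pot k (x + 1, y, s) + p2 * pot k (x, y + 1, s) + q * pot k (service (x, y, s))
     \<le> pot k (x, y, s) - (1 - ratio) * p2 * of_bool (s = 1 \<and> x \<ge> 1 \<and> y = int k)"
proof (cases "s = 1")
  case True
  then have "x \<ge> 1" and y: "y \<ge> 0"
    using z by (auto simp: polling_states_def)
  define i where "i = nat (x - 1)"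
  have x: "x = int (Suc i)" using \<open>x \<ge> 1\<close> by (simp add: i_def)
  \<comment> \<open>A service at \<open>x = 1\<close> leaves sheet 1 or empties the system. The
    potential is then 1, which is the value \<open>ratio ^ 0\<close> that harmonicity asks
    for.\<close>
  have sv: "pot k (service (x, y, s)) \<le> ratio ^ i + (1 - ratio) * of_bool (y \<le> int k)"
    using y True ratio_less_1 by (cases i) (auto simp: x pot_def service_def nat_add_distrib)
  have "p1 * pot k (x + 1, y, s) + p2 * pot k (x, y + 1, s) + q * pot k (service (x, y, s))
      \<le> p1 * (ratio ^ Suc (Suc i) + (1 - ratio) * of_bool (y \<le> int k))
      + p2 * (ratio ^ Suc i + (1 - ratio) * of_bool (y + 1 \<le> int k))
      + q * (ratio ^ i + (1 - ratio) * of_bool (y \<le> int k))"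
    using p1_pos p2_pos q_pos True
    by (intro add_mono mult_left_mono sv) (auto simp: pot_def x nat_add_distrib)
  also have "of_bool (y + 1 \<le> int k) = (of_bool (y \<le> int k) - of_bool (y = int k) :: real)"
    by auto
  also have "p1 * (ratio ^ Suc (Suc i) + (1 - ratio) * of_bool (y \<le> int k))
      + p2 * (ratio ^ Suc i + (1 - ratio) * (of_bool (y \<le> int k) - of_bool (y = int k)))
      + q * (ratio ^ i + (1 - ratio) * of_bool (y \<le> int k))
      = (p1 * ratio ^ Suc (Suc i) + p2 * ratio ^ Suc i + q * ratio ^ i)
        + (p1 + p2 + q) * ((1 - ratio) * of_bool (y \<le> int k)) - (1 - ratio) * p2 * of_bool (y = int k)"
    by (simp add: algebra_simps)
  also have "\<dots> = pot k (x, y, s) - (1 - ratio) * p2 * of_bool (s = 1 \<and> x \<ge> 1 \<and> y = int k)"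
    unfolding ratio_harmonic sum_one using True by (simp add: pot_def x nat_add_distrib)
  finally show ?thesis .
next
  case False
  then have "pot k (x + 1, y, s) = 1" "pot k (x, y + 1, s) = 1" "pot k (x, y, s) = 1"
    by (auto simp: pot_def)
  moreover have "q * pot k (service (x, y, s)) \<le> q * 1"
    using q_pos by (intro mult_left_mono pot_le_1) auto
  ultimately show ?thesis using False sum_one by simp
qed

text \<open>The factor \<open>gain ^ level\<close> undoes the twist, so that the potential can be
  tested against the original kernel. The product is unbounded and is cut off above level
  \<open>N\<close>; the cut does harm only on level \<open>N + 1\<close>.\<close>

definition test :: "nat \<Rightarrow> nat \<Rightarrow> state \<Rightarrow> real" where
  "test k N z = (if level z \<le> N then gain ^ level z * pot k z else 0)"

lemma test_nonneg: "0 \<le> test k N z"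
  using gain_pos pot_nonneg by (simp add: test_def)

lemma test_le: "test k N z \<le> gain ^ level z * pot k z"
  using gain_pos pot_nonneg by (simp add: test_def)

lemma test_bounded: "test k N z \<le> gain ^ N"
proof (cases "level z \<le> N")
  case True
  then have "gain ^ level z * pot k z \<le> gain ^ N * 1"
    using gain_gt_1 by (intro mult_mono power_increasing pot_le_1 pot_nonneg) auto
  then show ?thesis using True by (simp add: test_def)
qed (use gain_pos in \<open>simp add: test_def\<close>)

text \<open>Up to level \<open>N\<close> and away from the empty state this is
  \<open>pot_drift\<close> conjugated by \<open>gain ^ level\<close>. The two positive terms are
  errors: at the empty state a service does not lower the level, and from level \<open>N + 1\<close>
  it drops into the region where \<open>test\<close> need not vanish.\<close>

lemma step_test:
  assumes z: "z \<in> polling_states"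
  shows "step (test k N) z - test k N z \<le> indicator {(0, 0, 1)} z
     + m * gain ^ N * indicator {z. level z = Suc N} z
     - (1 - ratio) * p2 * gain ^ level z * of_bool (level z \<le> N \<and> (\<exists>x\<ge>1. z = (x, int k, 1)))"
proof -
  obtain x y s where zz: "z = (x, y, s)" by (cases z)
  show ?thesis
  proof (cases "z = (0, 0, 1)")
    case True
    have a: "test k N (1, 0, 1) \<le> gain * 1" "test k N (0, 1, 2) \<le> gain * 1"
      using order_trans[OF test_le[of k N "(1, 0, 1)"] mult_left_mono[OF pot_le_1]]
        order_trans[OF test_le[of k N "(0, 1, 2)"] mult_left_mono[OF pot_le_1]] gain_pos
      by (auto simp: level_def)
    have "step (test k N) z - test k N z = l1 * test k N (1, 0, 1) + l2 * test k N (0, 1, 2) + m * 1 - 1"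
      using True by (simp add: step_def test_def level_def pot_def)
    also have "\<dots> \<le> l1 * (gain * 1) + l2 * (gain * 1) + m * 1 - 1"
      using l1_pos l2_pos m_pos a by (intro diff_right_mono add_mono mult_left_mono) auto
    also have "\<dots> \<le> 1"
    proof -
      \<comment> \<open>One step after the empty state \<open>gain ^ level\<close> has mean
        \<open>2 * m\<close>, and \<open>2 * m - 1 \<le> 1\<close>.\<close>
      have "l1 * gain + l2 * gain = m" using m_gain by (simp add: q ring_distribs)
      then have "l1 * (gain * 1) + l2 * (gain * 1) + m * 1 - 1 = m + m - 1" by simp
      then show ?thesis using rates l1_pos l2_pos by linarith
    qed
    finally show ?thesis using True by (simp add: level_def)
  next
    case False
    note zs = z[unfolded zz] and z0 = False[unfolded zz]
    note up = level_up[OF zs] and dn = level_service[OF zs z0]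
    define n where "n = level (service (x, y, s))"
    have n: "level z = Suc n" using dn by (simp add: zz n_def)
    have st: "step (test k N) z = l1 * test k N (x + 1, y, s) + l2 * test k N (x, y + 1, s) + m * test k N (service (x, y, s))"
      unfolding step_def zz by (simp only: prod.case if_not_P[OF z0])
    consider "level z \<le> N" | "level z = Suc N" | "level z > Suc N" by linarith
    then show ?thesis
    proof cases
      case 1
      \<comment> \<open>Upper bounds suffice: on level \<open>N\<close> the two upward neighbours
        are already cut to 0, which only lowers \<open>step (test k N) z\<close>.\<close>
      have t: "test k N (x + 1, y, s) \<le> gain ^ Suc (Suc n) * pot k (x + 1, y, s)"
        "test k N (x, y + 1, s) \<le> gain ^ Suc (Suc n) * pot k (x, y + 1, s)"
        "test k N (service (x, y, s)) \<le> gain ^ n * pot k (service (x, y, s))"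
        using test_le[of k N "(x + 1, y, s)"] test_le[of k N "(x, y + 1, s)"]
          test_le[of k N "service (x, y, s)"] unfolding up n[unfolded zz] n_def .
      have "step (test k N) z \<le> l1 * (gain ^ Suc (Suc n) * pot k (x + 1, y, s))
          + l2 * (gain ^ Suc (Suc n) * pot k (x, y + 1, s)) + m * (gain ^ n * pot k (service (x, y, s)))"
        unfolding st
        by (rule add_mono[OF add_mono[OF mult_left_mono[OF t(1) less_imp_le[OF l1_pos]]
              mult_left_mono[OF t(2) less_imp_le[OF l2_pos]]] mult_left_mono[OF t(3) less_imp_le[OF m_pos]]])
      also have "\<dots> = gain ^ Suc n * (p1 * pot k (x + 1, y, s) + p2 * pot k (x, y + 1, s) + q * pot k (service (x, y, s)))"
      proof -
        have "l1 * (g ^ Suc (Suc n) * A) + l2 * (g ^ Suc (Suc n) * B) + M * (g ^ n * C)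
            = g ^ Suc n * (l1 * g * A + l2 * g * B + q * C)" if "q * g = M" for A B C g M :: real
          unfolding that[symmetric] by (simp add: ring_distribs mult_ac)
        from this[OF m_gain] show ?thesis unfolding p1_gain p2_gain .
      qed
      also have "\<dots> \<le> gain ^ Suc n * (pot k (x, y, s) - (1 - ratio) * p2 * of_bool (s = 1 \<and> x \<ge> 1 \<and> y = int k))"
        using gain_pos by (intro mult_left_mono pot_drift zs z0) auto
      also have "\<dots> = test k N z - (1 - ratio) * p2 * gain ^ level z * of_bool (level z \<le> N \<and> (\<exists>x\<ge>1. z = (x, int k, 1)))"
      proof -
        have "(level z \<le> N \<and> (\<exists>x\<ge>1. z = (x, int k, 1))) = (s = 1 \<and> x \<ge> 1 \<and> y = int k)"
          using 1 by (auto simp: zz)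
        moreover have "test k N z = gain ^ Suc n * pot k (x, y, s)"
          using 1 by (simp only: test_def if_True n) (simp add: zz)
        ultimately show ?thesis unfolding n by (simp only: right_diff_distrib[of "gain ^ Suc n"] mult_ac)
      qed
      finally show ?thesis using 1 False by (simp add: indicator_def)
    next
      case 2
      have "test k N (x + 1, y, s) = 0" "test k N (x, y + 1, s) = 0" "test k N z = 0"
        using 2 up by (auto simp: test_def zz)
      then have "step (test k N) z - test k N z = m * test k N (service (x, y, s))"
        by (simp add: st)
      also have "\<dots> \<le> m * gain ^ N"
        using m_pos test_bounded by (intro mult_left_mono) auto
      finally show ?thesis using 2 False by (simp add: indicator_def)
    next
      case 3
      have "test k N (x + 1, y, s) = 0" "test k N (x, y + 1, s) = 0" "test k N z = 0"
        "test k N (service (x, y, s)) = 0"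
        using 3 up n by (auto simp: test_def zz n_def)
      then show ?thesis using 3 False by (simp add: st indicator_def)
    qed
  qed
qed

text \<open>Column 0 is set to 0 by hand: this is the killing, and in row 0 it discards the empty
  state, the only state of sheet 1 with \<open>x = 0\<close>.\<close>

definition row :: "nat \<Rightarrow> nat \<Rightarrow> real" where
  "row y x = (if x = 0 then 0 else gain ^ (x + y) * pmf p (int x, int y, 1))"

text \<open>Under the stationary law \<open>test\<close> has mean drift 0, so the expected drop
  collected on row \<open>k\<close> is at most the two errors of \<open>step_test\<close>. The error
  on level \<open>N + 1\<close> is at most \<open>m\<close> because \<open>gain ^ n\<close> times
  the mass of level \<open>n\<close> never exceeds 1, so the bound is free of \<open>M\<close> and
  \<open>k\<close>.\<close>

lemma row_partial_sums: "(1 - ratio) * p2 * (\<Sum>x<M. row k x) \<le> 1 + m"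
proof -
  \<comment> \<open>Large enough that all points \<open>(x, k)\<close> with \<open>x < M\<close>
    survive the cut-off.\<close>
  define N where "N = M + k"
  define c where "c = (1 - ratio) * p2"
  have c: "c \<ge> 0" using ratio_less_1 p2_pos by (simp add: c_def)
  define I :: "nat \<Rightarrow> state \<Rightarrow> real" where "I x = indicator {(int x, int k, 1)}" for x
  have I: "integrable p (I x)" "measure_pmf.expectation p (I x) = pmf p (int x, int k, 1)" for x
    by (simp_all add: I_def measure_pmf_single)
  define g :: "state \<Rightarrow> real" where "g z = indicator {(0, 0, 1)} z
     + m * gain ^ N * indicator {z. level z = Suc N} z
     - (\<Sum>x\<in>{1..<M}. c * gain ^ (x + k) * I x z)" for z
  have "measure_pmf.expectation p (test k N) = measure_pmf.expectation p (step (test k N))"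
    by (rule expectation_step[OF test_nonneg test_bounded])
  also have "\<dots> \<le> measure_pmf.expectation p (\<lambda>z. test k N z + g z)"
  proof (rule integral_mono_AE)
    show "integrable p (step (test k N))"
      by (rule integrable_step[OF test_nonneg test_bounded])
    show "integrable p (\<lambda>z. test k N z + g z)"
      unfolding g_def
      by (intro Bochner_Integration.integrable_add Bochner_Integration.integrable_diff
          Bochner_Integration.integrable_sum integrable_mult_right integrable_indicator_pmf I
          measure_pmf.integrable_const_bound[where B = "gain ^ N" and f = "test k N"])
        (use test_nonneg test_bounded in auto)
    show "AE z in p. step (test k N) z \<le> test k N z + g z"
      using AE_states
    proof eventually_elim
      case (elim z)
      have "(\<Sum>x\<in>{1..<M}. c * gain ^ (x + k) * I x z)
        \<le> c * gain ^ level z * of_bool (level z \<le> N \<and> (\<exists>x\<ge>1. z = (x, int k, 1)))"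
      proof (cases "\<exists>x\<in>{1..<M}. z = (int x, int k, 1)")
        case True
        then obtain x where x: "x \<in> {1..<M}" "z = (int x, int k, 1)" by blast
        have "level z = x + k" using x by (simp add: level_def nat_add_distrib)
        moreover have "(\<Sum>x'\<in>{1..<M}. c * gain ^ (x' + k) * I x' z)
            = (\<Sum>x'\<in>{1..<M}. if x' = x then c * gain ^ (x + k) else 0)"
          using x by (intro sum.cong) (auto simp: I_def indicator_def)
        ultimately show ?thesis using x by (simp add: N_def)
      next
        case False
        then have "(\<Sum>x\<in>{1..<M}. c * gain ^ (x + k) * I x z) = 0"
          by (intro sum.neutral) (auto simp: I_def indicator_def)
        then show ?thesis using c gain_pos by simp
      qed
      with step_test[OF elim, of k N] show ?case
        unfolding g_def c_def by linarith
    qed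
  qed
  also have "\<dots> = measure_pmf.expectation p (test k N) + measure_pmf.expectation p g"
  proof (rule Bochner_Integration.integral_add)
    show "integrable p (test k N)"
      by (rule measure_pmf.integrable_const_bound[where B = "gain ^ N"]) (use test_nonneg test_bounded in auto)
    show "integrable p g"
      unfolding g_def
      by (intro Bochner_Integration.integrable_add Bochner_Integration.integrable_diff
          Bochner_Integration.integrable_sum integrable_mult_right integrable_indicator_pmf I)
  qed
  finally have "0 \<le> measure_pmf.expectation p g" by simp
  also have "measure_pmf.expectation p g = pmf p (0, 0, 1) + m * gain ^ N * measure p {z. level z = Suc N}
     - (\<Sum>x\<in>{1..<M}. c * gain ^ (x + k) * pmf p (int x, int k, 1))"
    unfolding g_def by (simp add: measure_pmf_single I)
  also have "(\<Sum>x\<in>{1..<M}. c * gain ^ (x + k) * pmf p (int x, int k, 1)) = c * (\<Sum>x<M. row k x)"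
  proof -
    have "(\<Sum>x<M. row k x) = (\<Sum>x\<in>{1..<M}. row k x)"
      by (rule sum.mono_neutral_right) (auto simp: row_def)
    then show ?thesis by (simp add: sum_distrib_left row_def mult_ac)
  qed
  also have "m * gain ^ N * measure p {z. level z = Suc N} \<le> m"
  proof -
    have "gain ^ N * measure p {z. level z = Suc N} \<le> gain ^ Suc N * measure p {z. level z = Suc N}"
      using gain_gt_1 by (intro mult_right_mono) auto
    also have "\<dots> \<le> 1" unfolding level_prob by simp
    finally show ?thesis using m_pos by (simp add: mult.assoc)
  qed
  also have "pmf p (0, 0, 1) \<le> 1" by (rule pmf_le_1)
  finally show ?thesis by (simp add: c_def)
qed

section \<open>The twisted rows satisfy the assumptions on \<open>a\<close>\<close>

lemma row_0: "row y 0 = 0"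
  by (simp add: row_def)

lemma row_nonneg: "0 \<le> row y x"
  using gain_pos by (simp add: row_def)

lemma row_summable: "summable (row y)"
proof (rule bounded_imp_summable[OF row_nonneg])
  fix n
  have c: "(1 - ratio) * p2 > 0" using ratio_less_1 p2_pos by simp
  show "(\<Sum>k\<le>n. row y k) \<le> (1 + m) / ((1 - ratio) * p2)"
    using row_partial_sums[of y "Suc n"] c by (simp add: lessThan_Suc_atMost pos_le_divide_eq mult.commute)
qed

lemma row_recurrence:
  "row (Suc y) (Suc x) = p1 * row (Suc y) x + p2 * row y (Suc x) + q * row (Suc y) (Suc (Suc x))"
proof -
  have "pmf p (int (Suc x), int (Suc y), 1) = l1 * pmf p (int x, int (Suc y), 1)
      + l2 * pmf p (int (Suc x), int y, 1) + m * pmf p (int (Suc (Suc x)), int (Suc y), 1)"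
    using balance[of "int (Suc x)" "int (Suc y)"] by (simp add: add_ac)
  \<comment> \<open>So the convention for column 0 changes nothing in the rows above the
    axis.\<close>
  moreover have "pmf p (0, int (Suc y), 1) = 0"
    by (rule pmf_eq_0) (auto simp: polling_states_def)
  ultimately have "pmf p (int (Suc x), int (Suc y), 1) = l1 * (if x = 0 then 0 else pmf p (int x, int (Suc y), 1))
      + l2 * pmf p (int (Suc x), int y, 1) + m * pmf p (int (Suc (Suc x)), int (Suc y), 1)"
    by auto
  then have "row (Suc y) (Suc x) = gain ^ (Suc x + Suc y) * (l1 * (if x = 0 then 0 else pmf p (int x, int (Suc y), 1))
      + l2 * pmf p (int (Suc x), int y, 1) + m * pmf p (int (Suc (Suc x)), int (Suc y), 1))"
    by (simp only: row_def) simp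
  also have "\<dots> = p1 * row (Suc y) x + p2 * row y (Suc x) + q * row (Suc y) (Suc (Suc x))"
  proof -
    have "g ^ (Suc x + Suc y) * (l1 * A + l2 * B + M * C)
      = l1 * g * (g ^ (x + Suc y) * A) + l2 * g * (g ^ (Suc x + y) * B) + q * (g ^ (Suc (Suc x) + Suc y) * C)"
      if "q * g = M" for A B C g M :: real
      unfolding that[symmetric] by (simp add: ring_distribs mult_ac)
    from this[OF m_gain, of "if x = 0 then 0 else pmf p (int x, int (Suc y), 1)"] show ?thesis
      unfolding row_def p1_gain p2_gain by (cases "x = 0") simp_all
  qed
  finally show ?thesis .
qed

section \<open>From the rows to the ray, and the final constant\<close>

lemma ray_limit:
  fixes d :: "nat \<Rightarrow> int \<times> int"
  assumes sum: "\<And>l. l \<ge> 1 \<Longrightarrow> fst (d l) + snd (d l) = int l"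
    and near1: "\<And>l. l \<ge> 1 \<Longrightarrow> \<bar>of_int (fst (d l)) - real l * (p1 - q) / L\<bar> \<le> D"
    and near2: "\<And>l. l \<ge> 1 \<Longrightarrow> \<bar>of_int (snd (d l)) - real l * p2 / L\<bar> \<le> D"
    and L: "L = p1 - q + p2"
  shows "(\<lambda>l. sqrt l * (gain ^ l * pmf p (fst (d l), snd (d l), 1)))
    \<longlonglongrightarrow> sqrt (L / p2) * ((\<Sum>x. row 0 x * (1 - ratio ^ x)) / sqrt (2 * pi * var))"
proof -
  define X N where "X l = nat (fst (d l))" and "N l = nat (snd (d l))" for l
  have Lpos: "L > 0" using drift p2_pos by (simp add: L)
  have big: "eventually (\<lambda>l. real l * c / L - D \<ge> Z) sequentially" if "c > 0" for c Z
  proof -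
    have "filterlim (\<lambda>l::nat. real l * (c / L) - D) at_top sequentially"
      using divide_pos_pos[OF that Lpos] by real_asymp
    then show ?thesis by (simp add: filterlim_at_top)
  qed
  have ev: "eventually (\<lambda>l. l \<ge> 1 \<and> real l * (p1 - q) / L - D \<ge> 1 \<and> real l * p2 / L - D \<ge> 1) sequentially"
    using big[of "p1 - q" 1] big[of p2 1] drift p2_pos eventually_ge_at_top[of 1]
    by (auto elim: eventually_elim2 intro: eventually_conj)
  then have ev: "eventually (\<lambda>l. l \<ge> 1 \<and> fst (d l) = int (X l) \<and> snd (d l) = int (N l)
      \<and> X l \<ge> 1 \<and> N l \<ge> 1 \<and> X l + N l = l) sequentially"
  proof eventually_elim
    case (elim l)
    then have "of_int (fst (d l)) \<ge> (1 :: real)" "of_int (snd (d l)) \<ge> (1 :: real)"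
      using near1[of l] near2[of l] by linarith+
    then have "fst (d l) \<ge> 1" "snd (d l) \<ge> 1" by simp_all
    then show ?case using elim sum[of l] by (auto simp: X_def N_def nat_add_distrib[symmetric])
  qed
  have N: "filterlim N at_top sequentially"
    unfolding filterlim_at_top
  proof
    fix Z :: nat
    show "eventually (\<lambda>l. Z \<le> N l) sequentially"
      using ev big[OF p2_pos, of "real Z"]
    proof eventually_elim
      case (elim l)
      then have "real Z \<le> real (N l)" using near2[of l] by simp
      then show ?case by simp
    qed
  qed
  \<comment> \<open>The ray has direction \<open>(p1 - q, p2)\<close>, so bounded distance from it
    means bounded deviation of \<open>X l\<close> from \<open>slope * N l\<close>.\<close>
  have slope: "\<bar>real (X l) - slope * N l\<bar> \<le> D + slope * D"
    if "l \<ge> 1" "fst (d l) = int (X l)" "snd (d l) = int (N l)" for l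
  proof -
    have s: "slope > 0" using drift p2_pos by (simp add: slope_def)
    have "real (X l) - slope * N l = (real (X l) - real l * (p1 - q) / L) - slope * (N l - real l * p2 / L)"
    proof -
      have "slope * (real l * p2 / L) = real l * (slope * p2) / L" by simp
      also have "slope * p2 = p1 - q" using p2_pos by (simp add: slope_def)
      finally show ?thesis by (simp only: right_diff_distrib[of slope])
    qed
    also have "\<bar>\<dots>\<bar> \<le> \<bar>real (X l) - real l * (p1 - q) / L\<bar> + \<bar>slope * (N l - real l * p2 / L)\<bar>"
      by (rule abs_triangle_ineq4)
    also have "\<bar>slope * (N l - real l * p2 / L)\<bar> = slope * \<bar>N l - real l * p2 / L\<bar>"
      using s by (simp add: abs_mult)
    also have "\<bar>real (X l) - real l * (p1 - q) / L\<bar> + slope * \<bar>N l - real l * p2 / L\<bar> \<le> D + slope * D"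
      using near1[OF that(1)] near2[OF that(1)] that s by (intro add_mono mult_left_mono) auto
    finally show ?thesis .
  qed
  have rows: "(\<lambda>l. sqrt (N l) * row (N l) (X l)) \<longlonglongrightarrow> (\<Sum>x. row 0 x * (1 - ratio ^ x)) / sqrt (2 * pi * var)"
  proof (rule rows_limit[where a = row, OF row_nonneg row_0 row_recurrence row_summable N])
    show "eventually (\<lambda>l. \<bar>real (X l) - slope * N l\<bar> \<le> D + slope * D) sequentially"
      using ev by eventually_elim (use slope in blast)
  qed
  \<comment> \<open>The local limit measures time by the height \<open>N l\<close>; measuring it by
    \<open>l\<close> instead costs the factor \<open>sqrt (L / p2)\<close>.\<close>
  have "(\<lambda>l. real (N l) / real l - p2 / L) \<longlonglongrightarrow> 0"
  proof (rule Lim_null_comparison)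
    show "(\<lambda>l. D / real l) \<longlonglongrightarrow> 0" by real_asymp
    show "eventually (\<lambda>l. norm (real (N l) / real l - p2 / L) \<le> D / real l) sequentially"
      using ev
    proof eventually_elim
      case (elim l)
      have "norm (real (N l) / real l - p2 / L) = \<bar>real (N l) - real l * p2 / L\<bar> / real l"
        using elim Lpos by (simp add: field_simps abs_divide)
      also have "\<dots> \<le> D / real l"
        using near2[of l] elim by (intro divide_right_mono) auto
      finally show ?case .
    qed
  qed
  then have "(\<lambda>l. real (N l) / real l) \<longlonglongrightarrow> p2 / L" by (simp add: LIM_zero_iff)
  then have "(\<lambda>l. sqrt (inverse (real (N l) / real l))) \<longlonglongrightarrow> sqrt (inverse (p2 / L))"
    using p2_pos Lpos by (intro tendsto_real_sqrt tendsto_inverse) auto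
  then have "(\<lambda>l. sqrt (real l / real (N l))) \<longlonglongrightarrow> sqrt (L / p2)" by simp
  from tendsto_mult[OF this rows]
  show ?thesis
  proof (rule Lim_transform_eventually)
    show "eventually (\<lambda>l. sqrt (real l / real (N l)) * (sqrt (N l) * row (N l) (X l))
        = sqrt l * (gain ^ l * pmf p (fst (d l), snd (d l), 1))) sequentially"
      using ev
    proof eventually_elim
      case (elim l)
      have "sqrt (real l / real (N l)) * sqrt (N l) = sqrt l"
        using elim by (simp flip: real_sqrt_mult)
      moreover have "row (N l) (X l) = gain ^ l * pmf p (fst (d l), snd (d l), 1)"
        using elim by (simp add: row_def)
      ultimately show ?case by (simp only: mult.assoc[symmetric])
    qed
  qed
qed

lemma boundary_sum_pos: "summable (\<lambda>x. row 0 x * (1 - ratio ^ x))" "(\<Sum>x. row 0 x * (1 - ratio ^ x)) > 0"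
proof -
  have nn: "0 \<le> row 0 x * (1 - ratio ^ x)" for x
    using row_nonneg ratio_pos ratio_less_1 by (simp add: power_le_one)
  show s: "summable (\<lambda>x. row 0 x * (1 - ratio ^ x))"
  proof (rule summable_comparison_test'[OF row_summable[of 0], of 0])
    fix x
    have "row 0 x * (1 - ratio ^ x) \<le> row 0 x * 1"
      using row_nonneg ratio_pos by (intro mult_left_mono) auto
    then show "norm (row 0 x * (1 - ratio ^ x)) \<le> row 0 x" using nn[of x] by simp
  qed
  have "0 < row 0 1 * (1 - ratio ^ 1)"
    using pmf_one_pos gain_pos ratio_less_1 by (simp add: row_def)
  then show "(\<Sum>x. row 0 x * (1 - ratio ^ x)) > 0"
    using suminf_pos2[OF s nn] by blast
qed

lemma polling_asymptotics:
  fixes d :: "nat \<Rightarrow> int \<times> int"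
  defines "F \<equiv> walk_increment p1 p2 q"
  defines "v \<equiv> mean_increment F" and "Q \<equiv> covariance_matrix F" and "r \<equiv> (l1 + l2) / m"
  defines "B \<equiv> (det Q * (v \<bullet> (matrix_inv Q *v v))) powr (-1/2) *
    (\<Sum>x. r powi (- int x) * pmf p (int x, 0, 1) * prob_never_hits F (int x, 0) outside_quadrant)"
  assumes nearest: "\<And>l. l \<ge> 1 \<Longrightarrow> nearest_on_line v l (d l)"
  shows "summable (\<lambda>x. r powi (- int x) * pmf p (int x, 0, 1) *
      prob_never_hits F (int x, 0) outside_quadrant) \<and>
    (\<lambda>l. pmf p (fst (d l), snd (d l), 1) / (B * r ^ l * (1 / sqrt (2 * pi * real l / l1_norm v))))
      \<longlonglongrightarrow> 1"
proof -
  define S where "S = (\<Sum>x. row 0 x * (1 - ratio ^ x))"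
  have S: "summable (\<lambda>x. row 0 x * (1 - ratio ^ x))" "S > 0"
    unfolding S_def by (rule boundary_sum_pos)+
  have v: "v = vector [p1 - q, p2]"
    unfolding v_def F_def by (rule covariance_walk_increment(1))
  have mpos: "v$1 > 0" "v$2 > 0" using drift p2_pos by (simp_all add: v)
  have L: "l1_norm v = p1 - q + p2"
    using drift p2_pos by (simp add: v l1_norm_def sum_2)
  have Lpos: "l1_norm v > 0" using drift p2_pos by (simp add: L)
  have r: "r = inverse gain"
    by (simp add: r_def gain_def)
  \<comment> \<open>The factor \<open>p2\<close> of the first upward step leaves the sum. At
    \<open>x = 0\<close> both sides vanish, so the convention \<open>row 0 0 = 0\<close> does no
    harm.\<close>
  have coeff: "r powi (- int x) * pmf p (int x, 0, 1) * prob_never_hits F (int x, 0) outside_quadrant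
      = p2 * (row 0 x * (1 - ratio ^ x))" for x
    unfolding F_def prob_never_hits_quadrant r by (simp add: row_def power_int_minus power_inverse)
  have quad: "det Q * (v \<bullet> (matrix_inv Q *v v)) = p2 ^ 3 * var"
    unfolding Q_def v_def F_def by (rule det_quadratic_form_covariance)
  have pos: "p2 ^ 3 * var > 0" using p2_pos var_pos by simp
  have B: "B = p2 * S / sqrt (p2 ^ 3 * var)"
    using B_def suminf_mult[OF S(1), of p2] pos
    unfolding coeff quad S_def by (simp add: powr_minus_divide powr_half_sqrt)
  have lim: "(\<lambda>l. sqrt l * (gain ^ l * pmf p (fst (d l), snd (d l), 1)))
    \<longlonglongrightarrow> sqrt (l1_norm v / p2) * (S / sqrt (2 * pi * var))"
    unfolding S_def
  proof (rule ray_limit[OF _ _ _ L])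
    fix l :: nat assume "l \<ge> 1"
    note n = nearest_on_line_components[OF mpos nearest[OF this]]
    have vv: "v$1 = p1 - q" "v$2 = p2" by (simp_all add: v)
    show "fst (d l) + snd (d l) = int l" by (rule n(1))
    show "\<bar>of_int (fst (d l)) - real l * (p1 - q) / l1_norm v\<bar> \<le> 2"
      "\<bar>of_int (snd (d l)) - real l * p2 / l1_norm v\<bar> \<le> 2"
      using n(2,3) unfolding vv L .
  qed
  have "(\<lambda>l. sqrt l * (gain ^ l * pmf p (fst (d l), snd (d l), 1)) * (sqrt (2 * pi / l1_norm v) / B))
    \<longlonglongrightarrow> sqrt (l1_norm v / p2) * (S / sqrt (2 * pi * var)) * (sqrt (2 * pi / l1_norm v) / B)"
    by (rule tendsto_mult_right[OF lim])
  moreover have "sqrt l * (gain ^ l * pmf p (fst (d l), snd (d l), 1)) * (sqrt (2 * pi / l1_norm v) / B)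
     = pmf p (fst (d l), snd (d l), 1) / (B * r ^ l * (1 / sqrt (2 * pi * real l / l1_norm v)))" for l
  proof -
    have "sqrt (2 * pi * real l / l1_norm v) = sqrt l * sqrt (2 * pi / l1_norm v)"
      by (simp flip: real_sqrt_mult)
    moreover have "r ^ l = 1 / gain ^ l" by (simp add: r power_inverse inverse_eq_divide power_divide)
    ultimately show ?thesis by (simp only:) (simp add: mult_ac)
  qed
  \<comment> \<open>The length of \<open>v\<close> cancels. The \<open>p2 ^ 3 * var\<close> of the
    covariance meets the \<open>var\<close> of the local limit and the \<open>p2\<close> of the time
    change; what remains is one factor \<open>p2\<close>, matched by that of the escape
    probability.\<close>
  moreover have "sqrt (l1_norm v / p2) * (S / sqrt (2 * pi * var)) * (sqrt (2 * pi / l1_norm v) / B) = 1"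
  proof -
    have "sqrt (l1_norm v / p2) * sqrt (2 * pi / l1_norm v) * sqrt (p2 ^ 3 * var)
        = sqrt (l1_norm v / p2 * (2 * pi / l1_norm v) * (p2 ^ 3 * var))"
      by (simp only: real_sqrt_mult)
    also have "l1_norm v / p2 * (2 * pi / l1_norm v) * (p2 ^ 3 * var) = p2\<^sup>2 * (2 * pi * var)"
      using Lpos p2_pos by (simp add: field_simps power2_eq_square power3_eq_cube)
    also have "sqrt \<dots> = p2 * sqrt (2 * pi * var)"
      using p2_pos by (simp only: real_sqrt_mult real_sqrt_abs abs_of_pos)
    finally have *: "sqrt (l1_norm v / p2) * sqrt (2 * pi / l1_norm v) * sqrt (p2 ^ 3 * var) = p2 * sqrt (2 * pi * var)" .
    have "sqrt (l1_norm v / p2) * (S / sqrt (2 * pi * var)) * (sqrt (2 * pi / l1_norm v) / B)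
      = (sqrt (l1_norm v / p2) * sqrt (2 * pi / l1_norm v) * sqrt (p2 ^ 3 * var)) / (p2 * sqrt (2 * pi * var))"
    proof -
      have "a * (S / e) * (b / (p2 * S / c)) = a * b * c / (p2 * e)" for a b c e :: real
        using S(2) p2_pos by (simp add: field_simps)
      then show ?thesis unfolding B .
    qed
    also have "\<dots> = 1"
      unfolding * using p2_pos var_pos by simp
    finally show ?thesis .
  qed
  ultimately have "(\<lambda>l. pmf p (fst (d l), snd (d l), 1) /
      (B * r ^ l * (1 / sqrt (2 * pi * real l / l1_norm v)))) \<longlonglongrightarrow> 1"
    by (simp only:)
  moreover have "summable (\<lambda>x. r powi (- int x) * pmf p (int x, 0, 1) *
      prob_never_hits F (int x, 0) outside_quadrant)"
    unfolding coeff by (rule summable_mult[OF S(1)])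
  ultimately show ?thesis by blast
qed

end

end

theorem theorem1:
  fixes lam1 lam2 \<mu> lam \<rho> tlam1 tlam2 t\<mu> B :: real
    and \<pi> :: "state pmf"
    and \<M> :: "(int \<times> int) pmf"
    and m :: "real ^ 2"
    and Q \<Sigma> :: "real ^ 2 ^ 2"
    and d :: "nat \<Rightarrow> int \<times> int"
  assumes "lam1 > 0" and "lam2 > 0" and "\<mu> > 0"
    and "lam = lam1 + lam2" and "lam < \<mu>" and "lam + \<mu> = 1" and "\<rho> = lam / \<mu>"
    and stationary: "stationary_on polling_states (polling_kernel lam1 lam2 \<mu>) \<pi>"
    and "tlam1 = lam1 * \<mu> / lam" and "tlam2 = lam2 * \<mu> / lam" and "t\<mu> = lam"
    and "\<M> = walk_increment tlam1 tlam2 t\<mu>"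
    and "m = mean_increment \<M>" and "Q = covariance_matrix \<M>" and "\<Sigma> = matrix_inv Q"
    and nearest: "\<And>l. l \<ge> 1 \<Longrightarrow> nearest_on_line m l (d l)"
    and ray: "tlam1 > t\<mu>"
    and "B = (det Q * (m \<bullet> (\<Sigma> *v m))) powr (-1/2) *
             (\<Sum>x. \<rho> powi (- int x) * pmf \<pi> (int x, 0, 1) *
                  prob_never_hits \<M> (int x, 0) outside_quadrant)"
  shows "summable (\<lambda>x. \<rho> powi (- int x) * pmf \<pi> (int x, 0, 1) *
                       prob_never_hits \<M> (int x, 0) outside_quadrant) \<and>
         (\<lambda>l. pmf \<pi> (fst (d l), snd (d l), 1) /
              (B * \<rho> ^ l * (1 / sqrt (2 * pi * real l / l1_norm m)))) \<longlonglongrightarrow> 1"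
proof -
  have lam: "lam > 0" using assms by simp
  have walk: "drift_walk tlam1 tlam2 t\<mu>"
  proof
    have "tlam1 + tlam2 = lam * \<mu> / lam"
      unfolding \<open>tlam1 = _\<close> \<open>tlam2 = _\<close> \<open>lam = lam1 + lam2\<close>
      by (simp add: ring_distribs add_divide_distrib)
    then show "tlam1 + tlam2 + t\<mu> = 1" using lam assms by simp
  qed (use assms lam in auto)
  have rates: "lam1 > 0" "lam2 > 0" "\<mu> > 0" "lam1 + lam2 + \<mu> = 1" "lam1 + lam2 < \<mu>"
    "stationary_on polling_states (polling_kernel lam1 lam2 \<mu>) \<pi>"
    "tlam1 = lam1 * \<mu> / (lam1 + lam2)" "tlam2 = lam2 * \<mu> / (lam1 + lam2)" "t\<mu> = lam1 + lam2"
    using assms by auto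
  have eqs: "walk_increment tlam1 tlam2 t\<mu> = \<M>" "mean_increment \<M> = m" "covariance_matrix \<M> = Q"
    "matrix_inv Q = \<Sigma>" "(lam1 + lam2) / \<mu> = \<rho>"
    using assms by auto
  show ?thesis
    using drift_walk.polling_asymptotics[OF walk rates, unfolded eqs, OF nearest]
    unfolding \<open>B = _\<close> .
qed

end
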